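(* Let $X_1, X_2, \ldots$ be i.i.d.\ with $\mathbb{P}\{X_1 = 2^k\} = 2^{-k}$, $k \in \mathbb{N}$, let $S_n = X_1 + \cdots + X_n$, $X_n^* = \max_{1 \leq i \leq n} X_i$, and $\gamma_n = n/2^{\lceil \log_2 n\rceil}$. Then \[ \sup_{x \in \mathbb{R}} \left| \mathbb{P}\left\{ \frac{S_n - X_n^*}{n} - \log_2 n \leq x\right\} - G^*_{\gamma_n}(x)\right| \to 0, \quad n \to \infty, \] where for $\gamma \in (1/2,1]$ \[ G^*_\gamma(x) = \sum_{j=-\infty}^\infty \sum_{m=1}^\infty G_{j-1,\gamma}\left(x - (m-1)2^j/\gamma\right) r_{j,\gamma}(m)\, p_{j,\gamma}. \]
   Context: For $j \in \mathbb{Z}$ and $\gamma \in [1/2,1]$: $p_{j,\gamma} = e^{-\gamma 2^{-j}}(1 - e^{-\gamma 2^{-j}})$; $r_{j,\gamma}(m) = \frac{(2^{-j}\gamma)^m}{m!}\left(e^{2^{-j}\gamma}-1\right)^{-1}$ for $m \geq 1$ (a Poisson$(\gamma 2^{-j})$ law conditioned to be nonzero); $G_{j,\gamma}$ is the distribution function of the infinitely divisible random variable $W_{j,\gamma}$ with characteristic function \[ \mathbb{E} e^{\mathrm{i} t W_{j,\gamma}} = \exp\left[ \mathrm{i} t u_{j,\gamma} + \int_0^\infty \left(e^{\mathrm{i} t x} - 1 - \mathrm{i} t x\right) \mathrm{d} L_{j,\gamma}(x)\right], \] where $u_{j,\gamma} = j - \log_2 \gamma$ and $L_{j,\gamma}(x)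 = \gamma 2^{-j} - \frac{2^{\{\log_2(\gamma x)\}}}{x}$ for $0 < x < 2^j \gamma^{-1}$, $L_{j,\gamma}(x) = 0$ for $x \geq 2^j\gamma^{-1}$. Here $\{y\}$ is the fractional part of $y$. *)

theory Defs
  imports "HOL-Probability.Probability"
begin

definition p_jg :: "int \<Rightarrow> real \<Rightarrow> real" where
  "p_jg j \<gamma> = exp (- \<gamma> * 2 powr (- real_of_int j)) * (1 - exp (- \<gamma> * 2 powr (- real_of_int j)))"

definition r_jg :: "int \<Rightarrow> real \<Rightarrow> nat \<Rightarrow> real" where
  "r_jg j \<gamma> m = (2 powr (- real_of_int j) * \<gamma>) ^ m / fact m
                  / (exp (2 powr (- real_of_int j) * \<gamma>) - 1)"

definition u_jg :: "int \<Rightarrow> real \<Rightarrow> real" where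
  "u_jg j \<gamma> = real_of_int j - log 2 \<gamma>"

definition L_jg :: "int \<Rightarrow> real \<Rightarrow> real \<Rightarrow> real" where
  "L_jg j \<gamma> x = (if 0 < x \<and> x < 2 powr (real_of_int j) / \<gamma>
                   then \<gamma> * 2 powr (- real_of_int j) - 2 powr (frac (log 2 (\<gamma> * x))) / x
                   else 0)"

definition Lmeas_jg :: "int \<Rightarrow> real \<Rightarrow> real measure" where
  "Lmeas_jg j \<gamma> = (THE N. sets N = sets borel \<and> emeasure N {..0} = 0 \<and>
      (\<forall>a b. 0 < a \<and> a \<le> b \<longrightarrow> emeasure N {a<..b} = ennreal (L_jg j \<gamma> b - L_jg j \<gamma> a)))"

definition phi_jg :: "int \<Rightarrow> real \<Rightarrow> real \<Rightarrow> complex" where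
  "phi_jg j \<gamma> t = exp (\<i> * complex_of_real (t * u_jg j \<gamma>)
      + (CLINT x : {0<..} | Lmeas_jg j \<gamma>. iexp (t * x) - 1 - \<i> * complex_of_real (t * x)))"

definition W_law :: "int \<Rightarrow> real \<Rightarrow> real measure" where
  "W_law j \<gamma> = (THE \<mu>. real_distribution \<mu> \<and> (\<forall>t. char \<mu> t = phi_jg j \<gamma> t))"

definition G_jg :: "int \<Rightarrow> real \<Rightarrow> real \<Rightarrow> real" where
  "G_jg j \<gamma> x = cdf (W_law j \<gamma>) x"

definition Gstar :: "real \<Rightarrow> real \<Rightarrow> real" where
  "Gstar \<gamma> x = (\<Sum>\<^sub>\<infinity>(j, m) \<in> (UNIV :: int set) \<times> {1::nat..}.
       G_jg (j - 1) \<gamma> (x - (real m - 1) * 2 powr (real_of_int j) / \<gamma>) * r_jg j \<gamma> m * p_jg j \<gamma>)"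

end

theory Submission
  imports Defs
begin

text \<open>
  Write \<open>n = \<gamma> * 2 ^ N\<close> with \<open>N = \<lceil>log 2 n\<rceil>\<close>. Since \<open>exp (i t S) 1{X* = 2^K}\<close> is the
  difference of \<open>exp (i t S) 1{X* \<le> 2^K}\<close> and \<open>exp (i t S) 1{X* \<le> 2^(K-1)}\<close>, independence gives the
  characteristic function of \<open>(S - X*) / n\<close> as \<open>\<Sum>K. exp (- i t 2^K / n) (a\<^sub>K^n - a\<^sub>K\<^sub>-\<^sub>1^n)\<close>, where
  \<open>a\<^sub>K\<close> is the expectation of \<open>exp (i t X / n)\<close> over \<open>X \<le> 2^K\<close>. The law with distribution function
  \<open>G*\<^sub>\<gamma>\<close> has a characteristic function of the same form, \<open>a\<^sub>K^n\<close> with \<open>K = N + j\<close> being replaced by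
  \<open>exp (- \<gamma> 2^(-j))\<close> times the characteristic function of \<open>W\<^sub>j\<^sub>,\<^sub>\<gamma>\<close>, and up to the centering
  \<open>exp (n (a\<^sub>K - 1))\<close> is exactly that expression with the small atoms of the Levy measure
  dropped. Both sums over \<open>j\<close> are truncated with the same error bound, uniformly in \<open>n\<close>. As \<open>\<gamma>\<close> ranges over
  the compact interval \<open>[1/2, 1]\<close>, along subsequences both laws converge weakly to one \<open>G*\<^sub>\<gamma>\<close>, and
  this convergence is uniform because \<open>G*\<^sub>\<gamma>\<close> is continuous: the characteristic function of
  \<open>W\<^sub>j\<^sub>,\<^sub>\<gamma>\<close> decays exponentially.
\<close>

section \<open>The Levy measure of the limit laws\<close>

text \<open>\<open>Lmeas_jg\<close> and \<open>W_law\<close> are definite descriptions, so nothing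
  can be said about \<open>G_jg\<close> before existence and uniqueness are proved for both. Mass
  times atom is always 1. Hence the Levy measure is infinite near 0, and every compensator
  contributes exactly \<open>- i t\<close>. This is where the centering \<open>log 2 n\<close> comes
  from: \<open>n (a_K - 1)\<close> is a sum of \<open>K\<close> uncompensated jumps, compensating
  them costs \<open>i t K\<close>, and \<open>K - log 2 n = j - log 2 \<gamma>\<close> is the drift
  \<open>u_jg\<close>. The factor \<open>exp (- \<gamma> 2^(-j))\<close> is the asymptotic value of
  \<open>(1 - 2^(-K))^n\<close>, the probability that the maximum is at most \<open>2^K\<close>. The
  weights \<open>p_jg\<close> and \<open>r_jg\<close> sit inside the difference of two consecutive
  levels: given the level of the maximum, the number of ties is Poisson conditioned to be nonzero,
  and summing over it reproduces a difference of two exponentials. Since \<open>\<gamma>\<close>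
  keeps oscillating with \<open>n\<close> there is no single limit law; the comparisons are
  differences tending to 0, and limits are taken only along subsequences.\<close>

text \<open>
  The function \<open>L_jg j \<gamma>\<close> is a step function; its jumps are \<open>\<gamma> 2^(-k)\<close> at \<open>2^k / \<gamma>\<close> for
  \<open>k \<le> j\<close>. The index below is \<open>l = j - k\<close>.
\<close>

definition levy_mass :: "int \<Rightarrow> real \<Rightarrow> nat \<Rightarrow> real" where
  "levy_mass j \<gamma> l = \<gamma> * 2 powr (- real_of_int j) * 2 ^ l"

definition levy_atom :: "int \<Rightarrow> real \<Rightarrow> nat \<Rightarrow> real" where
  "levy_atom j \<gamma> l = 2 powr real_of_int j / \<gamma> * (1 / 2) ^ l"

definition levy_measure :: "int \<Rightarrow> real \<Rightarrow> real measure" where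
  "levy_measure j \<gamma> = distr (density (count_space UNIV) (\<lambda>l. ennreal (levy_mass j \<gamma> l)))
     borel (levy_atom j \<gamma>)"

lemma levy_mass_pos: "\<gamma> > 0 \<Longrightarrow> levy_mass j \<gamma> l > 0"
  by (simp add: levy_mass_def)

lemma levy_atom_pos: "\<gamma> > 0 \<Longrightarrow> levy_atom j \<gamma> l > 0"
  by (simp add: levy_atom_def)

lemma levy_mass_atom: "\<gamma> > 0 \<Longrightarrow> levy_mass j \<gamma> l * levy_atom j \<gamma> l = 1"
  by (simp add: levy_mass_def levy_atom_def powr_minus field_simps power_divide)

lemma summable_levy_atom: "summable (levy_atom j \<gamma>)"
  unfolding levy_atom_def by (intro summable_mult summable_geometric) simp

lemma sets_levy_measure [simp, measurable_cong]: "sets (levy_measure j \<gamma>) = sets borel"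
  by (simp add: levy_measure_def)

lemma emeasure_levy_measure:
  assumes [measurable]: "A \<in> sets borel"
  shows "emeasure (levy_measure j \<gamma>) A
    = (\<Sum>l. ennreal (levy_mass j \<gamma> l) * indicator A (levy_atom j \<gamma> l))"
proof -
  have "emeasure (levy_measure j \<gamma>) A
      = (\<integral>\<^sup>+l. ennreal (levy_mass j \<gamma> l) * indicator (levy_atom j \<gamma> -` A) l \<partial>count_space UNIV)"
    unfolding levy_measure_def by (subst emeasure_distr) (auto simp: emeasure_density)
  also have "\<dots> = (\<integral>\<^sup>+l. ennreal (levy_mass j \<gamma> l) * indicator A (levy_atom j \<gamma> l) \<partial>count_space UNIV)"
    by (intro nn_integral_cong) (auto split: split_indicator)
  finally show ?thesis by (simp add: nn_integral_count_space_nat)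
qed

text \<open>Only finitely many atoms exceed a positive level, although the total mass is infinite;
  this turns tails into finite sums.\<close>

lemma levy_atom_gt_iff:
  assumes "\<gamma> > 0" "a > 0"
  shows "a < levy_atom j \<gamma> l \<longleftrightarrow> l < nat (j - \<lfloor>log 2 (\<gamma> * a)\<rfloor>)"
proof -
  have "levy_atom j \<gamma> l = 2 powr (real_of_int j - real l) / \<gamma>"
    by (simp add: levy_atom_def powr_diff powr_realpow power_divide)
  then have "\<gamma> * levy_atom j \<gamma> l = 2 powr (real_of_int (j - int l))"
    using assms by simp
  then have "a < levy_atom j \<gamma> l \<longleftrightarrow> \<gamma> * a < 2 powr (real_of_int (j - int l))"
    using assms by (metis mult_less_cancel_left_pos)
  also have "\<dots> \<longleftrightarrow> log 2 (\<gamma> * a) < real_of_int (j - int l)"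
    using assms by (intro log_less_iff[symmetric]) auto
  also have "\<dots> \<longleftrightarrow> \<lfloor>log 2 (\<gamma> * a)\<rfloor> < j - int l"
    by (metis floor_less_iff)
  also have "\<dots> \<longleftrightarrow> l < nat (j - \<lfloor>log 2 (\<gamma> * a)\<rfloor>)" by linarith
  finally show ?thesis .
qed

text \<open>The masses beyond \<open>a\<close> form a geometric sum with \<open>j - f\<close> terms,
  \<open>f\<close> the floor of \<open>log 2 (\<gamma> * a)\<close>; the fractional part in
  \<open>L_jg\<close> is the trace of that floor. So \<open>L_jg\<close> is minus the tail of the
  measure.\<close>

lemma L_jg_eq:
  assumes "\<gamma> > 0" "a > 0"
  shows "- L_jg j \<gamma> a = (\<Sum>l<nat (j - \<lfloor>log 2 (\<gamma> * a)\<rfloor>). levy_mass j \<gamma> l)"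
proof -
  define f where "f = \<lfloor>log 2 (\<gamma> * a)\<rfloor>"
  have sum: "(\<Sum>l<m. levy_mass j \<gamma> l) = \<gamma> * 2 powr (- real_of_int j) * (2 ^ m - 1)" for m
    unfolding levy_mass_def sum_distrib_left[symmetric]
    using geometric_sum[of "2::real" m] by simp
  have fr: "2 powr frac (log 2 (\<gamma> * a)) = \<gamma> * a / 2 powr f"
    using assms by (simp add: frac_def powr_diff f_def)
  show ?thesis
  proof (cases "a < 2 powr real_of_int j / \<gamma>")
    case True
    then have "a < levy_atom j \<gamma> 0" by (simp add: levy_atom_def)
    then have m: "0 < nat (j - f)" using levy_atom_gt_iff[OF assms, of j 0] by (simp add: f_def)
    then have "(2::real) ^ nat (j - f) = 2 powr (real_of_int j - f)"
      by (simp add: powr_realpow[symmetric])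
    then have pow: "2 powr f * 2 ^ nat (j - f) = 2 powr real_of_int j"
      by (simp add: powr_diff)
    have "2 powr frac (log 2 (\<gamma> * a)) / a = \<gamma> / 2 powr f"
      using assms by (simp add: fr)
    also have "\<dots> = \<gamma> * 2 powr (- real_of_int j) * 2 ^ nat (j - f)"
      by (simp add: pow[symmetric] powr_minus field_simps)
    finally show ?thesis using True assms unfolding sum f_def[symmetric] L_jg_def
      by (simp add: algebra_simps)
  next
    case False
    then have "\<not> a < levy_atom j \<gamma> 0" by (simp add: levy_atom_def)
    then have m: "nat (j - f) = 0" using levy_atom_gt_iff[OF assms, of j 0] by (simp add: f_def)
    then show ?thesis using False unfolding f_def[symmetric] m L_jg_def by simp
  qed
qed

lemma emeasure_levy_measure_greaterThan:
  assumes "\<gamma> > 0" "a > 0"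
  shows "emeasure (levy_measure j \<gamma>) {a<..} = ennreal (- L_jg j \<gamma> a)"
proof -
  let ?m = "nat (j - \<lfloor>log 2 (\<gamma> * a)\<rfloor>)"
  have "emeasure (levy_measure j \<gamma>) {a<..}
      = (\<Sum>l. ennreal (levy_mass j \<gamma> l) * indicator {a<..} (levy_atom j \<gamma> l))"
    by (rule emeasure_levy_measure) simp
  also have "\<dots> = (\<Sum>l<?m. ennreal (levy_mass j \<gamma> l) * indicator {a<..} (levy_atom j \<gamma> l))"
    using levy_atom_gt_iff[OF assms] by (intro suminf_finite) (auto split: split_indicator)
  also have "\<dots> = (\<Sum>l<?m. ennreal (levy_mass j \<gamma> l))"
    using levy_atom_gt_iff[OF assms] by (intro sum.cong) (auto split: split_indicator)
  also have "\<dots> = ennreal (\<Sum>l<?m. levy_mass j \<gamma> l)"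
    using levy_mass_pos[OF assms(1)] by (intro sum_ennreal) (simp add: less_imp_le)
  finally show ?thesis using L_jg_eq[OF assms] by simp
qed

lemma emeasure_levy_measure_Ioc:
  assumes "\<gamma> > 0" "0 < a" "a \<le> b"
  shows "emeasure (levy_measure j \<gamma>) {a<..b} = ennreal (L_jg j \<gamma> b - L_jg j \<gamma> a)"
proof -
  have "- L_jg j \<gamma> b \<ge> 0"
    using assms levy_mass_pos[OF assms(1)] by (subst L_jg_eq) (auto intro!: sum_nonneg simp: less_imp_le)
  moreover have "{a<..b} = {a<..} - {b<..}" by auto
  moreover have "emeasure (levy_measure j \<gamma>) ({a<..} - {b<..})
      = emeasure (levy_measure j \<gamma>) {a<..} - emeasure (levy_measure j \<gamma>) {b<..}"
    using assms emeasure_levy_measure_greaterThan[of \<gamma> b j] by (intro emeasure_Diff) auto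
  ultimately show ?thesis
    using assms by (simp add: emeasure_levy_measure_greaterThan ennreal_minus)
qed

lemma emeasure_levy_measure_nonpos:
  assumes "\<gamma> > 0"
  shows "emeasure (levy_measure j \<gamma>) {..0} = 0"
proof -
  have "emeasure (levy_measure j \<gamma>) {..0}
    = (\<Sum>l. ennreal (levy_mass j \<gamma> l) * indicator {..0} (levy_atom j \<gamma> l))"
    by (rule emeasure_levy_measure) simp
  also have "\<dots> = (\<Sum>l. 0)"
    using levy_atom_pos[OF assms] by (intro suminf_cong) (auto split: split_indicator simp: not_le)
  finally show ?thesis by simp
qed

text \<open>Gives uniqueness in the description \<open>Lmeas_jg\<close>. The measures may be
  infinite near 0, so distribution functions cannot be compared; the generator consists of intervals
  away from 0 together with all Borel subsets of the null set \<open>{..0}\<close>.\<close>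

lemma measure_eqI_pos_Ioc:
  fixes M N :: "real measure"
  assumes sets: "sets M = sets borel" "sets N = sets borel"
    and null: "emeasure M {..0} = 0" "emeasure N {..0} = 0"
    and fin: "\<And>a b. 0 < a \<Longrightarrow> a \<le> b \<Longrightarrow> emeasure M {a<..b} \<noteq> \<infinity>"
    and eq: "\<And>a b. 0 < a \<Longrightarrow> a \<le> b \<Longrightarrow> emeasure M {a<..b} = emeasure N {a<..b}"
  shows "M = N"
proof -
  let ?E = "{A. A \<in> sets borel \<and> A \<subseteq> {..0::real}} \<union> {{a<..b} |a b. 0 < a \<and> a \<le> b}"
  have Ioc: "{c<..d} \<in> {{a<..b} |a b. 0 < a \<and> a \<le> b}" if "0 < c" "c \<le> d" for c d :: real
    using that by blast
  have null': "emeasure M A = 0" "emeasure N A = 0" if "A \<in> sets borel" "A \<subseteq> {..0}" for A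
    using emeasure_mono[OF that(2), of M] emeasure_mono[OF that(2), of N] sets null by auto
  have borel: "sets borel = sigma_sets UNIV ?E"
  proof
    have "{..x} \<in> sigma_sets UNIV ?E" for x :: real
    proof (cases "x \<le> 0")
      case True then show ?thesis by (intro sigma_sets.Basic) auto
    next
      case False
      have "{..x} = {..0} \<union> (\<Union>n. {x / real (Suc n)<..x})" (is "_ = ?R")
      proof -
        have "\<exists>n. x / real (Suc n) < y" if "0 < y" for y
        proof -
          obtain n where "x / y < real n" using reals_Archimedean2 by blast
          then show ?thesis using that by (intro exI[of _ n]) (simp add: field_simps add_strict_increasing)
        qed
        then show ?thesis using False by (auto simp: not_le) (meson not_le)
      qed
      moreover have "?R \<in> sigma_sets UNIV ?E"
      proof (rule sigma_sets_Un)
        show "(\<Union>n. {x / real (Suc n)<..x}) \<in> sigma_sets UNIV ?E"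
        proof (rule sigma_sets.Union)
          fix n
          have "{x / real (Suc n)<..x} \<in> {{a<..b} |a b. 0 < a \<and> a \<le> b}"
            using False by (intro Ioc) (auto simp: field_simps)
          then show "{x / real (Suc n)<..x} \<in> sigma_sets UNIV ?E" by (intro sigma_sets.Basic) blast
        qed
      qed (intro sigma_sets.Basic, auto)
      ultimately show ?thesis by simp
    qed
    then have "sigma_sets UNIV (range atMost) \<subseteq> sigma_sets UNIV ?E"
      by (intro sigma_sets_mono) auto
    then show "sets borel \<subseteq> sigma_sets UNIV ?E"
      by (simp add: borel_eq_atMost[where 'a=real])
    have "?E \<subseteq> sets borel" by auto
    from sets.sigma_sets_subset[OF this] show "sigma_sets UNIV ?E \<subseteq> sets borel" by simp
  qed
  \<comment> \<open>An exhaustion of the line by sets of finite measure: the null set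
    \<open>{..0}\<close> and intervals bounded away from 0.\<close>
  define A where "A n = (case n of 0 \<Rightarrow> {..0::real} | Suc k \<Rightarrow> {1 / real (Suc k)<..real (Suc k)})" for n
  show ?thesis
  proof (rule measure_eqI_generator_eq[where E="?E" and \<Omega>=UNIV and A=A])
    show "Int_stable ?E"
    proof (rule Int_stableI)
      fix a b assume ab: "a \<in> ?E" "b \<in> ?E"
      then consider "a \<in> sets borel" "a \<subseteq> {..0}" | "b \<in> sets borel" "b \<subseteq> {..0}"
        | c d e f where "a = {c<..d}" "b = {e<..f}" "0 < c" "c \<le> d" "0 < e" "e \<le> f"
        by blast
      then show "a \<inter> b \<in> ?E"
      proof cases
        case 1 then show ?thesis using ab by auto
      next
        case 2 then show ?thesis using ab by auto
      next
        case 3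
        \<comment> \<open>Disjoint intervals must also meet in a member of the generator; the outer
          \<open>max\<close> makes it the empty interval \<open>{c<..c}\<close>, which the condition
          \<open>a \<le> b\<close> admits.\<close>
        then have "a \<inter> b = {max c e<..max (max c e) (min d f)}" by auto
        moreover have "{max c e<..max (max c e) (min d f)} \<in> {{a<..b} |a b. 0 < a \<and> a \<le> b}"
          using 3 by (intro Ioc) auto
        ultimately show ?thesis by simp
      qed
    qed
    show "emeasure M X = emeasure N X" if "X \<in> ?E" for X
      using that null' eq by auto
    show "sets M = sigma_sets UNIV ?E" "sets N = sigma_sets UNIV ?E"
      using borel sets by auto
    show "range A \<subseteq> ?E"
    proof (rule image_subsetI)
      fix n show "A n \<in> ?E"
      proof (cases n)
        case (Suc k)
        show ?thesis unfolding Suc A_def nat.case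
          by (intro UnI2 Ioc) (auto simp: field_simps)
      qed (simp add: A_def)
    qed
    show "(\<Union>i. A i) = UNIV"
    proof -
      have "\<exists>n. x \<in> A n" for x
      proof (cases "x \<le> 0")
        case True then show ?thesis by (intro exI[of _ 0]) (simp add: A_def)
      next
        case False
        obtain n where n: "max x (1 / x) < real n" using reals_Archimedean2 by blast
        then show ?thesis using False
          by (intro exI[of _ "Suc n"]) (auto simp: A_def field_simps)
      qed
      then show ?thesis by auto
    qed
    show "emeasure M (A i) \<noteq> \<infinity>" for i
      using null fin[of "1 / real i" "real i"] by (cases i) (auto simp: A_def field_simps)
  qed auto
qed

lemma Lmeas_jg_eq:
  assumes "\<gamma> > 0"
  shows "Lmeas_jg j \<gamma> = levy_measure j \<gamma>"
  unfolding Lmeas_jg_def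
proof (rule the_equality)
  show "sets (levy_measure j \<gamma>) = sets borel \<and> emeasure (levy_measure j \<gamma>) {..0} = 0 \<and>
    (\<forall>a b. 0 < a \<and> a \<le> b \<longrightarrow> emeasure (levy_measure j \<gamma>) {a<..b} = ennreal (L_jg j \<gamma> b - L_jg j \<gamma> a))"
    using emeasure_levy_measure_Ioc[OF assms] emeasure_levy_measure_nonpos[OF assms] by simp
next
  fix N assume "sets N = sets borel \<and> emeasure N {..0} = 0 \<and>
    (\<forall>a b. 0 < a \<and> a \<le> b \<longrightarrow> emeasure N {a<..b} = ennreal (L_jg j \<gamma> b - L_jg j \<gamma> a))"
  then show "N = levy_measure j \<gamma>"
    using emeasure_levy_measure_Ioc[OF assms] emeasure_levy_measure_nonpos[OF assms]
    by (intro measure_eqI_pos_Ioc) auto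
qed

section \<open>The Levy exponent as a series over the atoms\<close>

definition levy_term :: "int \<Rightarrow> real \<Rightarrow> real \<Rightarrow> nat \<Rightarrow> complex" where
  "levy_term j \<gamma> t l = of_real (levy_mass j \<gamma> l) *
     (iexp (t * levy_atom j \<gamma> l) - 1 - \<i> * of_real (t * levy_atom j \<gamma> l))"

definition levy_exponent :: "int \<Rightarrow> real \<Rightarrow> real \<Rightarrow> complex" where
  "levy_exponent j \<gamma> t = \<i> * of_real (t * (real_of_int j - log 2 \<gamma>)) + (\<Sum>l. levy_term j \<gamma> t l)"

lemma norm_iexp_minus_1_minus: "norm (iexp x - 1 - \<i> * of_real x) \<le> x\<^sup>2 / 2"
  using iexp_approx1[of x 1] by (simp add: numeral_2_eq_2 algebra_simps)

lemma norm_iexp_minus_1: "norm (iexp x - 1) \<le> \<bar>x\<bar>"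
  using iexp_approx1[of x 0] by simp

text \<open>The quadratic bound costs mass times squared atom, which is a single atom because mass
  times atom is 1; the atoms are geometric. Without the compensator small atoms would each
  contribute about \<open>i t\<close>, and the series would diverge.\<close>

lemma norm_levy_term:
  assumes "\<gamma> > 0"
  shows "norm (levy_term j \<gamma> t l) \<le> t\<^sup>2 / 2 * levy_atom j \<gamma> l"
proof -
  have "norm (levy_term j \<gamma> t l)
      = levy_mass j \<gamma> l * norm (iexp (t * levy_atom j \<gamma> l) - 1 - \<i> * of_real (t * levy_atom j \<gamma> l))"
    using levy_mass_pos[OF assms, of j l] by (simp add: levy_term_def norm_mult)
  also have "\<dots> \<le> levy_mass j \<gamma> l * ((t * levy_atom j \<gamma> l)\<^sup>2 / 2)"
    using norm_iexp_minus_1_minus[of "t * levy_atom j \<gamma> l"] levy_mass_pos[OF assms, of j l]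
    by (intro mult_left_mono) auto
  also have "\<dots> = (levy_mass j \<gamma> l * levy_atom j \<gamma> l) * (t\<^sup>2 / 2 * levy_atom j \<gamma> l)"
    by (simp add: power2_eq_square)
  finally show ?thesis using levy_mass_atom[OF assms] by simp
qed

lemma summable_norm_levy_term:
  assumes "\<gamma> > 0"
  shows "summable (\<lambda>l. norm (levy_term j \<gamma> t l))"
  by (rule summable_comparison_test'[OF summable_mult[OF summable_levy_atom, of "t\<^sup>2 / 2"]])
     (use norm_levy_term[OF assms] in auto)

lemma phi_jg_eq:
  assumes "\<gamma> > 0"
  shows "phi_jg j \<gamma> t = exp (levy_exponent j \<gamma> t)"
proof -
  let ?f = "\<lambda>x. iexp (t * x) - 1 - \<i> * complex_of_real (t * x)"
  have "(CLINT x : {0<..} | levy_measure j \<gamma>. ?f x)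
      = (\<integral>l. indicator {0<..} (levy_atom j \<gamma> l) *\<^sub>R ?f (levy_atom j \<gamma> l)
          \<partial>density (count_space UNIV) (\<lambda>l. ennreal (levy_mass j \<gamma> l)))"
    unfolding levy_measure_def set_lebesgue_integral_def by (subst integral_distr) auto
  also have "\<dots> = (\<integral>l. levy_mass j \<gamma> l *\<^sub>R (indicator {0<..} (levy_atom j \<gamma> l) *\<^sub>R ?f (levy_atom j \<gamma> l))
          \<partial>count_space UNIV)"
    using levy_mass_pos[OF assms] by (intro integral_density) (auto simp: less_imp_le)
  also have "\<dots> = (\<integral>l. levy_term j \<gamma> t l \<partial>count_space UNIV)"
    using levy_atom_pos[OF assms] by (intro Bochner_Integration.integral_cong)
      (auto simp: levy_term_def scaleR_conv_of_real)
  also have "\<dots> = (\<Sum>l. levy_term j \<gamma> t l)"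
    using summable_norm_levy_term[OF assms]
    by (intro integral_count_space_nat) (simp add: integrable_count_space_nat_iff)
  finally show ?thesis
    unfolding phi_jg_def Lmeas_jg_eq[OF assms] levy_exponent_def u_jg_def by simp
qed

section \<open>Existence of the infinitely divisible laws\<close>

lemma integral_measure_pmf_nat_sums:
  fixes f :: "nat \<Rightarrow> 'b::{banach, second_countable_topology}"
  assumes "summable (\<lambda>k. pmf p k * norm (f k))"
  shows "integrable (measure_pmf p) f"
    and "(\<lambda>k. pmf p k *\<^sub>R f k) sums (\<integral>k. f k \<partial>measure_pmf p)"
proof -
  have i: "integrable (count_space UNIV) (\<lambda>k. pmf p k *\<^sub>R f k)"
    using assms by (simp add: integrable_count_space_nat_iff)
  then show "integrable (measure_pmf p) f"
    unfolding measure_pmf_eq_density by (subst integrable_density) auto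
  have "(\<integral>k. f k \<partial>measure_pmf p) = (\<integral>k. pmf p k *\<^sub>R f k \<partial>count_space UNIV)"
    unfolding measure_pmf_eq_density by (intro integral_density) auto
  then show "(\<lambda>k. pmf p k *\<^sub>R f k) sums (\<integral>k. f k \<partial>measure_pmf p)"
    using sums_integral_count_space_nat[OF i] by simp
qed

text \<open>The last two are factorial moments; the shift from \<open>k\<close> to
  \<open>Suc k\<close> cancels one factor of the factorial and reduces each to the series before
  it.\<close>

lemma poisson_series:
  fixes s :: real
  shows "(\<lambda>k. s ^ k / fact k) sums exp s"
    and "(\<lambda>k. real k * (s ^ k / fact k)) sums (s * exp s)"
    and "(\<lambda>k. real k * (real k - 1) * (s ^ k / fact k)) sums (s\<^sup>2 * exp s)"
proof -
  show 0: "(\<lambda>k. s ^ k / fact k) sums exp s"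
    using exp_converges[of s] by (simp add: divide_inverse mult.commute)
  have e: "real (Suc k) * (s ^ Suc k / fact (Suc k)) = s * (s ^ k / fact k)" for k
    by (simp del: of_nat_Suc)
  have "(\<lambda>k. real (Suc k) * (s ^ Suc k / fact (Suc k))) sums (s * exp s)"
    unfolding e by (rule sums_mult[OF 0])
  then show 1: "(\<lambda>k. real k * (s ^ k / fact k)) sums (s * exp s)"
    by (subst (asm) sums_Suc_iff) simp
  have e: "real (Suc k) * (real (Suc k) - 1) * (s ^ Suc k / fact (Suc k))
      = s * (real k * (s ^ k / fact k))" for k
  proof -
    have "real (Suc k) * (real (Suc k) - 1) * (s ^ Suc k / fact (Suc k))
        = (real (Suc k) - 1) * (real (Suc k) * (s ^ Suc k / fact (Suc k)))"
      by (simp only: mult_ac)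
    then show ?thesis by (simp only: e) simp
  qed
  have "(\<lambda>k. real (Suc k) * (real (Suc k) - 1) * (s ^ Suc k / fact (Suc k))) sums (s * (s * exp s))"
    unfolding e by (rule sums_mult[OF 1])
  then show "(\<lambda>k. real k * (real k - 1) * (s ^ k / fact k)) sums (s\<^sup>2 * exp s)"
    by (subst (asm) sums_Suc_iff) (simp add: power2_eq_square mult.assoc)
qed

lemma poisson_variance:
  fixes s :: real
  assumes "s > 0"
  shows "integrable (measure_pmf (poisson_pmf s)) (\<lambda>k. (real k - s)\<^sup>2)"
    and "(\<integral>k. (real k - s)\<^sup>2 \<partial>measure_pmf (poisson_pmf s)) = s"
proof -
  \<comment> \<open>Expands \<open>(k - s)^2\<close> as
    \<open>k (k - 1) + (1 - 2 s) k + s^2\<close>, in terms of factorial moments.\<close>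
  have "(\<lambda>k. exp (- s) * (real k * (real k - 1) * (s ^ k / fact k)
      + (1 - 2 * s) * (real k * (s ^ k / fact k)) + s\<^sup>2 * (s ^ k / fact k)))
      sums (exp (- s) * (s\<^sup>2 * exp s + (1 - 2 * s) * (s * exp s) + s\<^sup>2 * exp s))"
    by (intro sums_mult sums_add poisson_series)
  also have "exp (- s) * (s\<^sup>2 * exp s + (1 - 2 * s) * (s * exp s) + s\<^sup>2 * exp s)
      = s * (exp (- s) * exp s)" by (simp add: algebra_simps power2_eq_square)
  also have "\<dots> = s" by (simp add: exp_minus)
  also have "(\<lambda>k. exp (- s) * (real k * (real k - 1) * (s ^ k / fact k)
      + (1 - 2 * s) * (real k * (s ^ k / fact k)) + s\<^sup>2 * (s ^ k / fact k)))
     = (\<lambda>k. pmf (poisson_pmf s) k * (real k - s)\<^sup>2)"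
  proof
    fix k
    have "real k * (real k - 1) * r + (1 - 2 * s) * (real k * r) + s\<^sup>2 * r = r * (real k - s)\<^sup>2" for r
      by (simp add: algebra_simps power2_eq_square)
    then show "exp (- s) * (real k * (real k - 1) * (s ^ k / fact k)
      + (1 - 2 * s) * (real k * (s ^ k / fact k)) + s\<^sup>2 * (s ^ k / fact k))
      = pmf (poisson_pmf s) k * (real k - s)\<^sup>2"
      by (simp only: pmf_poisson[OF assms] mult.assoc) (simp only: mult.commute[of "exp (- s)"] mult.assoc)
  qed
  finally have sums: "(\<lambda>k. pmf (poisson_pmf s) k * (real k - s)\<^sup>2) sums s" .
  then have sm: "summable (\<lambda>k. pmf (poisson_pmf s) k * norm ((real k - s)\<^sup>2))"
    by (simp add: sums_iff)
  show "integrable (measure_pmf (poisson_pmf s)) (\<lambda>k. (real k - s)\<^sup>2)"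
    by (rule integral_measure_pmf_nat_sums[OF sm])
  show "(\<integral>k. (real k - s)\<^sup>2 \<partial>measure_pmf (poisson_pmf s)) = s"
    using sums_unique2[OF integral_measure_pmf_nat_sums(2)[OF sm]] sums by simp
qed

text \<open>The inequality of arithmetic and geometric means, weighted by \<open>sqrt s\<close>,
  plays the part of Cauchy-Schwarz. The order \<open>sqrt s\<close> instead of \<open>s\<close> is
  decisive: atom times mass is 1, but atom times root of the mass is summable.\<close>

lemma poisson_abs_deviation:
  fixes s :: real
  assumes "s > 0"
  shows "integrable (measure_pmf (poisson_pmf s)) (\<lambda>k. real k - s)"
    and "(\<integral>k. \<bar>real k - s\<bar> \<partial>measure_pmf (poisson_pmf s)) \<le> sqrt s"
proof -
  have le: "\<bar>x\<bar> \<le> (sqrt s + x\<^sup>2 / sqrt s) / 2" for x :: real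
  proof -
    have "0 \<le> (\<bar>x\<bar> - sqrt s)\<^sup>2" by simp
    then have "2 * \<bar>x\<bar> * sqrt s \<le> x\<^sup>2 + sqrt s * sqrt s"
      by (simp only: power2_diff power2_abs power2_eq_square[of "sqrt s"] algebra_simps)
    then show ?thesis using assms by (simp add: field_simps)
  qed
  have i: "integrable (measure_pmf (poisson_pmf s)) (\<lambda>k. (sqrt s + (real k - s)\<^sup>2 / sqrt s) / 2)"
    using poisson_variance(1)[OF assms] by simp
  show j: "integrable (measure_pmf (poisson_pmf s)) (\<lambda>k. real k - s)"
    by (rule Bochner_Integration.integrable_bound[OF i]) (use le assms in \<open>auto intro: order_trans[OF le abs_ge_self]\<close>)
  have "(\<integral>k. \<bar>real k - s\<bar> \<partial>measure_pmf (poisson_pmf s))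
      \<le> (\<integral>k. (sqrt s + (real k - s)\<^sup>2 / sqrt s) / 2 \<partial>measure_pmf (poisson_pmf s))"
    using i j le by (intro integral_mono) auto
  also have "\<dots> = (sqrt s + s / sqrt s) / 2"
    using poisson_variance[OF assms] by simp
  also have "\<dots> = sqrt s"
    using assms by (simp add: real_div_sqrt)
  finally show "(\<integral>k. \<bar>real k - s\<bar> \<partial>measure_pmf (poisson_pmf s)) \<le> sqrt s" .
qed

lemma integral_iexp_poisson:
  fixes s u :: real
  assumes "s > 0"
  shows "(\<integral>k. iexp (u * real k) \<partial>measure_pmf (poisson_pmf s)) = exp (of_real s * (iexp u - 1))"
proof -
  have "(\<lambda>k. of_real (exp (- s)) * ((of_real s * iexp u) ^ k /\<^sub>R fact k))
      sums (of_real (exp (- s)) * exp (of_real s * iexp u))"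
    by (intro sums_mult exp_converges)
  also have "of_real (exp (- s)) * exp (of_real s * iexp u) = exp (of_real s * (iexp u - 1))"
    by (simp add: exp_of_real[symmetric] exp_add[symmetric] algebra_simps)
  also have "(\<lambda>k. of_real (exp (- s)) * ((of_real s * iexp u) ^ k /\<^sub>R fact k))
      = (\<lambda>k. (s ^ k / fact k * exp (- s)) *\<^sub>R iexp (u * real k))"
    by (rule ext) (simp add: scaleR_conv_of_real power_mult_distrib exp_of_nat_mult[symmetric] field_simps)
  finally have sums: "(\<lambda>k. (s ^ k / fact k * exp (- s)) *\<^sub>R iexp (u * real k)) sums exp (of_real s * (iexp u - 1))" .
  have "summable (\<lambda>k. pmf (poisson_pmf s) k * norm (iexp (u * real k)))"
    using sums_summable[OF sums_mult2[OF poisson_series(1)[of s], of "exp (-s)"]] assms by simp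
  from integral_measure_pmf_nat_sums(2)[OF this]
  show "(\<integral>k. iexp (u * real k) \<partial>measure_pmf (poisson_pmf s)) = exp (of_real s * (iexp u - 1))"
    using sums_unique2[OF sums] assms by simp
qed

text \<open>Independent variables are realised on the infinite product space. By Tonelli the sum of
  their absolute values has finite mean, so the series converges almost surely, and dominated
  convergence with bound 1 passes to the limit in the characteristic functions.\<close>

lemma exists_distribution_infinite_convolution:
  fixes \<nu> :: "nat \<Rightarrow> real measure"
  assumes \<nu>: "\<And>l. real_distribution (\<nu> l)"
    and int: "\<And>l. integrable (\<nu> l) (\<lambda>x. x)"
    and summ: "summable (\<lambda>l. \<integral>x. \<bar>x\<bar> \<partial>\<nu> l)"
  shows "\<exists>\<mu>. real_distribution \<mu> \<and> (\<forall>t. (\<lambda>m. \<Prod>l<m. char (\<nu> l) t) \<longlonglongrightarrow> char \<mu> t)"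
proof -
  interpret \<nu>: real_distribution "\<nu> l" for l by (rule \<nu>)
  have ps: "prob_space (\<nu> l)" for l by (rule \<nu>.prob_space_axioms)
  define M where "M = PiM UNIV \<nu>"
  interpret prob_space M unfolding M_def by (rule prob_space_PiM) (rule ps)
  define X where "X l \<omega> = (\<omega> l :: real)" for l :: nat and \<omega> :: "nat \<Rightarrow> real"
  have mX[measurable]: "X l \<in> borel_measurable M" for l
    using measurable_component_singleton[of l UNIV \<nu>]
    by (simp add: X_def[abs_def] M_def cong: measurable_cong_sets)
  have dX: "distr M borel (X l) = \<nu> l" for l
  proof -
    have "distr M borel (X l) = distr M (\<nu> l) (X l)" by (intro distr_cong) auto
    then show ?thesis
      using distr_PiM_component[of UNIV \<nu> l] ps by (simp add: X_def[abs_def] M_def)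
  qed
  have "indep_vars (\<lambda>_. borel) X UNIV"
  proof (subst indep_vars_iff_distr_eq_PiM')
    have "distr M (Pi\<^sub>M UNIV (\<lambda>_. borel)) (\<lambda>x. \<lambda>i\<in>UNIV. X i x) = distr M M (\<lambda>x. x)"
      by (intro distr_cong) (auto simp: M_def X_def intro!: sets_PiM_cong)
    then show "distr M (Pi\<^sub>M UNIV (\<lambda>_. borel)) (\<lambda>x. \<lambda>i\<in>UNIV. X i x) = Pi\<^sub>M UNIV (\<lambda>i. distr M borel (X i))"
      by (simp add: dX) (simp add: M_def)
  qed auto
  then have indep: "indep_vars (\<lambda>_. borel) X {..<m}" for m
    by (rule indep_vars_subset) simp
  have "(\<integral>\<^sup>+\<omega>. (\<Sum>l. ennreal \<bar>X l \<omega>\<bar>) \<partial>M) = (\<Sum>l. \<integral>\<^sup>+\<omega>. ennreal \<bar>X l \<omega>\<bar> \<partial>M)"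
    by (intro nn_integral_suminf) measurable
  also have "\<dots> = (\<Sum>l. ennreal (\<integral>x. \<bar>x\<bar> \<partial>\<nu> l))"
  proof (intro suminf_cong)
    fix l
    have "(\<integral>\<^sup>+\<omega>. ennreal \<bar>X l \<omega>\<bar> \<partial>M) = (\<integral>\<^sup>+x. ennreal \<bar>x\<bar> \<partial>distr M borel (X l))"
      by (subst nn_integral_distr) auto
    also have "\<dots> = ennreal (\<integral>x. \<bar>x\<bar> \<partial>\<nu> l)"
      unfolding dX using int[of l] by (intro nn_integral_eq_integral) auto
    finally show "(\<integral>\<^sup>+\<omega>. ennreal \<bar>X l \<omega>\<bar> \<partial>M) = ennreal (\<integral>x. \<bar>x\<bar> \<partial>\<nu> l)" .
  qed
  also have "\<dots> \<noteq> \<infinity>"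
    using summ by (simp add: ennreal_suminf_neq_top)
  finally have "AE \<omega> in M. (\<Sum>l. ennreal \<bar>X l \<omega>\<bar>) \<noteq> \<infinity>"
    by (intro nn_integral_PInf_AE) auto
  then have ae: "AE \<omega> in M. summable (\<lambda>l. X l \<omega>)"
  proof eventually_elim
    case (elim \<omega>)
    then have "summable (\<lambda>l. \<bar>X l \<omega>\<bar>)" by (intro summable_suminf_not_top) auto
    then show ?case by (rule summable_rabs_cancel)
  qed
  \<comment> \<open>Where the series diverges, \<open>suminf\<close> is an unspecified value; by
    \<open>ae\<close> this happens only on a null set.\<close>
  define \<mu> where "\<mu> = distr M borel (\<lambda>\<omega>. \<Sum>l. X l \<omega>)"
  have "(\<lambda>m. \<Prod>l<m. char (\<nu> l) t) \<longlonglongrightarrow> char \<mu> t" for t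
  proof -
    have "(\<lambda>m. \<integral>\<omega>. iexp (t * (\<Sum>l<m. X l \<omega>)) \<partial>M) \<longlonglongrightarrow> (\<integral>\<omega>. iexp (t * (\<Sum>l. X l \<omega>)) \<partial>M)"
    proof (rule integral_dominated_convergence[where w="\<lambda>_. 1"])
      show "AE \<omega> in M. (\<lambda>m. iexp (t * (\<Sum>l<m. X l \<omega>))) \<longlonglongrightarrow> iexp (t * (\<Sum>l. X l \<omega>))"
        using ae
      proof eventually_elim
        case (elim \<omega>)
        then have "(\<lambda>m. \<Sum>l<m. X l \<omega>) \<longlonglongrightarrow> (\<Sum>l. X l \<omega>)" by (rule summable_LIMSEQ)
        then show ?case by (intro tendsto_intros)
      qed
    qed auto
    moreover have "(\<integral>\<omega>. iexp (t * (\<Sum>l<m. X l \<omega>)) \<partial>M) = (\<Prod>l<m. char (\<nu> l) t)" for m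
    proof -
      have "(\<integral>\<omega>. iexp (t * (\<Sum>l<m. X l \<omega>)) \<partial>M) = char (distr M borel (\<lambda>\<omega>. \<Sum>l<m. X l \<omega>)) t"
        unfolding char_def by (subst integral_distr) auto
      then show ?thesis by (simp add: char_distr_sum[OF indep] dX)
    qed
    moreover have "(\<integral>\<omega>. iexp (t * (\<Sum>l. X l \<omega>)) \<partial>M) = char \<mu> t"
      unfolding char_def \<mu>_def by (subst integral_distr) auto
    ultimately show ?thesis by simp
  qed
  moreover have "real_distribution \<mu>" unfolding \<mu>_def by simp
  ultimately show ?thesis by blast
qed

lemma char_distr_affine:
  assumes "real_distribution \<mu>"
  shows "char (distr \<mu> borel (\<lambda>x. x + c)) t = iexp (t * c) * char \<mu> t"
proof -
  interpret real_distribution \<mu> by fact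
  show ?thesis unfolding char_def
    by (subst integral_distr) (auto simp: distrib_left exp_add mult.commute)
qed

text \<open>
  A sum of independent compensated Poisson variables; it converges absolutely in mean because
  the \<open>l\<close>-th deviation is at most \<open>levy_atom * sqrt levy_mass\<close>, a geometric sequence.
\<close>

lemma exists_W_law:
  assumes \<gamma>: "\<gamma> > 0"
  shows "\<exists>\<mu>. real_distribution \<mu> \<and> (\<forall>t. char \<mu> t = exp (levy_exponent j \<gamma> t))"
proof -
  define P where "P l = measure_pmf (poisson_pmf (levy_mass j \<gamma> l))" for l
  define h where "h l k = levy_atom j \<gamma> l * (real k - levy_mass j \<gamma> l)" for l and k :: nat
  define \<nu> where "\<nu> l = distr (P l) borel (h l)" for l
  note pos = levy_mass_pos[OF \<gamma>, of j] levy_atom_pos[OF \<gamma>, of j]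
  have psP: "prob_space (P l)" for l unfolding P_def by (rule prob_space_measure_pmf)
  have mh[measurable]: "h l \<in> borel_measurable (P l)" for l by (simp add: P_def)
  have rd: "real_distribution (\<nu> l)" for l
    unfolding \<nu>_def by (rule prob_space.real_distribution_distr[OF psP]) (rule mh)
  have int: "integrable (\<nu> l) (\<lambda>x. x)" for l
  proof -
    have "integrable (P l) (h l)"
      unfolding P_def h_def using poisson_abs_deviation(1)[OF pos(1)] by simp
    then show ?thesis unfolding \<nu>_def by (subst integrable_distr_eq) auto
  qed
  have summ: "summable (\<lambda>l. \<integral>x. \<bar>x\<bar> \<partial>\<nu> l)"
  proof (rule summable_comparison_test')
    let ?b = "\<lambda>l. 2 powr real_of_int j / \<gamma> * sqrt (\<gamma> * 2 powr (- real_of_int j)) * (sqrt (1 / 2)) ^ l"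
    show "summable ?b" by (intro summable_mult summable_geometric) (simp add: real_sqrt_divide)
    show "norm (\<integral>x. \<bar>x\<bar> \<partial>\<nu> l) \<le> ?b l" for l
    proof -
      have "(\<integral>x. \<bar>x\<bar> \<partial>\<nu> l) = (\<integral>k. \<bar>h l k\<bar> \<partial>P l)"
        unfolding \<nu>_def by (subst integral_distr) auto
      also have "\<dots> = levy_atom j \<gamma> l * (\<integral>k. \<bar>real k - levy_mass j \<gamma> l\<bar> \<partial>P l)"
        using pos(2)[of l] by (simp add: h_def abs_mult)
      also have "\<dots> \<le> levy_atom j \<gamma> l * sqrt (levy_mass j \<gamma> l)"
        unfolding P_def using poisson_abs_deviation(2)[OF pos(1)] pos(2)[of l]
        by (intro mult_left_mono) (auto simp: less_imp_le)
      also have "\<dots> = 2 powr real_of_int j / \<gamma> * sqrt (\<gamma> * 2 powr (- real_of_int j)) * (1 / 2 * sqrt 2) ^ l"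
        by (simp add: levy_atom_def levy_mass_def real_sqrt_mult real_sqrt_power power_mult_distrib power_divide)
      also have "1 / 2 * sqrt 2 = sqrt (1 / 2 :: real)"
        by (simp add: real_sqrt_divide field_simps)
      finally show ?thesis by (simp add: abs_of_nonneg integral_nonneg_AE)
    qed
  qed
  have char: "char (\<nu> l) t = exp (levy_term j \<gamma> t l)" for l t
  proof -
    let ?m = "levy_mass j \<gamma> l" and ?x = "levy_atom j \<gamma> l"
    have "char (\<nu> l) t = (\<integral>k. iexp (t * h l k) \<partial>P l)"
      unfolding char_def \<nu>_def by (subst integral_distr) auto
    also have "\<dots> = (\<integral>k. iexp (- (t * ?x * ?m)) * iexp (t * ?x * real k) \<partial>P l)"
      by (intro Bochner_Integration.integral_cong) (auto simp: h_def exp_add[symmetric] algebra_simps)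
    also have "\<dots> = iexp (- (t * ?x * ?m)) * (\<integral>k. iexp (t * ?x * real k) \<partial>P l)"
      by simp
    also have "\<dots> = iexp (- (t * ?x * ?m)) * exp (of_real ?m * (iexp (t * ?x) - 1))"
      unfolding P_def by (simp only: integral_iexp_poisson[OF pos(1)])
    also have "\<dots> = exp (levy_term j \<gamma> t l)"
      by (simp add: levy_term_def exp_add[symmetric] algebra_simps)
    finally show ?thesis .
  qed
  obtain \<mu> where rd\<mu>: "real_distribution \<mu>"
      and lim\<mu>: "\<forall>t. (\<lambda>m. \<Prod>l<m. char (\<nu> l) t) \<longlonglongrightarrow> char \<mu> t"
    using exists_distribution_infinite_convolution[where \<nu>=\<nu>, OF rd int summ] by blast
  have "char \<mu> t = exp (\<Sum>l. levy_term j \<gamma> t l)" for t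
  proof (rule LIMSEQ_unique[OF spec[OF lim\<mu>, of t]])
    have "(\<lambda>m. \<Sum>l<m. levy_term j \<gamma> t l) \<longlonglongrightarrow> (\<Sum>l. levy_term j \<gamma> t l)"
      by (rule summable_LIMSEQ[OF summable_norm_cancel[OF summable_norm_levy_term[OF \<gamma>]]])
    then have "(\<lambda>m. exp (\<Sum>l<m. levy_term j \<gamma> t l)) \<longlonglongrightarrow> exp (\<Sum>l. levy_term j \<gamma> t l)"
      by (rule tendsto_exp)
    then show "(\<lambda>m. \<Prod>l<m. char (\<nu> l) t) \<longlonglongrightarrow> exp (\<Sum>l. levy_term j \<gamma> t l)"
      by (simp only: char exp_sum[OF finite_lessThan])
  qed
  \<comment> \<open>The compensated jumps have mean 0, so the drift has to be supplied by a
    shift.\<close>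
  then have "char (distr \<mu> borel (\<lambda>x. x + (real_of_int j - log 2 \<gamma>))) t = exp (levy_exponent j \<gamma> t)" for t
    by (simp only: char_distr_affine[OF rd\<mu>] levy_exponent_def exp_add)
  moreover have "real_distribution (distr \<mu> borel (\<lambda>x. x + (real_of_int j - log 2 \<gamma>)))"
  proof -
    interpret real_distribution \<mu> by (rule rd\<mu>)
    show ?thesis by simp
  qed
  ultimately show ?thesis by (intro exI conjI allI)
qed

lemma W_law:
  assumes \<gamma>: "\<gamma> > 0"
  shows real_distribution_W_law: "real_distribution (W_law j \<gamma>)"
    and char_W_law: "char (W_law j \<gamma>) t = exp (levy_exponent j \<gamma> t)"
proof -
  obtain \<mu> where \<mu>: "real_distribution \<mu>" "\<And>t. char \<mu> t = exp (levy_exponent j \<gamma> t)"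
    using exists_W_law[OF \<gamma>] by blast
  have "W_law j \<gamma> = \<mu>"
    unfolding W_law_def
  proof (rule the_equality)
    show "real_distribution \<mu> \<and> (\<forall>t. char \<mu> t = phi_jg j \<gamma> t)"
      using \<mu> by (simp add: phi_jg_eq[OF \<gamma>])
    show "\<nu> = \<mu>" if "real_distribution \<nu> \<and> (\<forall>t. char \<nu> t = phi_jg j \<gamma> t)" for \<nu>
      using that \<mu> by (intro Levy_uniqueness) (auto simp: phi_jg_eq[OF \<gamma>])
  qed
  then show "real_distribution (W_law j \<gamma>)" "char (W_law j \<gamma>) t = exp (levy_exponent j \<gamma> t)"
    using \<mu> by auto
qed

section \<open>Continuity of the limit laws\<close>

lemma Re_levy_term: "Re (levy_term j \<gamma> t l) = levy_mass j \<gamma> l * (cos (t * levy_atom j \<gamma> l) - 1)"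
  by (simp add: levy_term_def Re_exp)

text \<open>Every term has nonpositive real part and the drift is purely imaginary, so discarding
  all atoms but one can only increase the real part.\<close>

lemma Re_levy_exponent_le:
  assumes \<gamma>: "\<gamma> > 0"
  shows "Re (levy_exponent j \<gamma> t) \<le> levy_mass j \<gamma> l * (cos (t * levy_atom j \<gamma> l) - 1)"
proof -
  have sm: "summable (levy_term j \<gamma> t)"
    by (rule summable_norm_cancel[OF summable_norm_levy_term[OF \<gamma>]])
  then have sums: "(\<lambda>l. - Re (levy_term j \<gamma> t l)) sums (- Re (levy_exponent j \<gamma> t))"
    by (intro sums_minus) (simp add: levy_exponent_def sums_Re summable_sums)
  have nonneg: "0 \<le> - Re (levy_term j \<gamma> t k)" for k
    using levy_mass_pos[OF \<gamma>, of j k] by (simp add: Re_levy_term mult_nonneg_nonpos)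
  have "(\<Sum>k\<in>{l}. - Re (levy_term j \<gamma> t k)) \<le> (\<Sum>k. - Re (levy_term j \<gamma> t k))"
    using nonneg sums by (intro sum_le_suminf) (auto simp: sums_iff)
  then show ?thesis using sums by (simp add: sums_iff Re_levy_term)
qed

lemma Re_levy_exponent_nonpos: "\<gamma> > 0 \<Longrightarrow> Re (levy_exponent j \<gamma> t) \<le> 0"
  using Re_levy_exponent_le[of \<gamma> j t 0] levy_mass_pos[of \<gamma> j 0]
  by (smt (verit) cos_le_one mult_nonneg_nonpos)

lemma dyadic_bracket:
  fixes y :: real
  assumes "1 \<le> y"
  obtains l :: nat where "2 ^ l \<le> y" "y < 2 ^ Suc l"
proof -
  define l where "l = (LEAST l. y < 2 ^ Suc l)"
  obtain k where "y < 2 ^ k" using real_arch_pow[of 2 y] by auto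
  then have "y < 2 ^ Suc k" by (simp add: less_le_trans)
  then have 1: "y < 2 ^ Suc l" unfolding l_def by (rule LeastI)
  moreover have "2 ^ l \<le> y"
  proof (cases l)
    case (Suc m)
    then have "\<not> y < 2 ^ Suc m" using not_less_Least[of m "\<lambda>l. y < 2 ^ Suc l"] l_def by auto
    then show ?thesis using Suc by simp
  qed (use assms in simp)
  ultimately show ?thesis using that by blast
qed

text \<open>One atom suffices: the \<open>l\<close> with \<open>\<bar>t\<bar> * levy_atom j \<gamma> l\<close> in \<open>[1, 2)\<close>.\<close>

lemma Re_levy_exponent_linear:
  assumes \<gamma>: "\<gamma> > 0" and t: "1 \<le> \<bar>t\<bar> * levy_atom j \<gamma> 0"
  shows "Re (levy_exponent j \<gamma> t) \<le> - ((1 - cos 1) * \<bar>t\<bar> / 2)"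
proof -
  obtain l :: nat where l: "2 ^ l \<le> \<bar>t\<bar> * levy_atom j \<gamma> 0" "\<bar>t\<bar> * levy_atom j \<gamma> 0 < 2 ^ Suc l"
    using dyadic_bracket[OF t] by blast
  define y where "y = \<bar>t\<bar> * levy_atom j \<gamma> l"
  have y: "y = \<bar>t\<bar> * levy_atom j \<gamma> 0 / 2 ^ l"
    by (simp add: y_def levy_atom_def power_divide)
  have y12: "1 \<le> y" "y < 2" using l by (auto simp: y field_simps)
  \<comment> \<open>\<open>[1, 2)\<close> lies in \<open>[0, pi]\<close>, where the cosine
    decreases. The halved \<open>\<bar>t\<bar>\<close> below comes from \<open>y < 2\<close> and
    mass times atom being 1.\<close>
  have "cos y \<le> cos 1"
    using y12 pi_gt3 by (intro cos_monotone_0_pi_le) auto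
  moreover have "\<bar>t\<bar> / 2 \<le> levy_mass j \<gamma> l"
  proof -
    have "\<bar>t\<bar> = levy_mass j \<gamma> l * y"
      using levy_mass_atom[OF \<gamma>, of j l] by (simp add: y_def algebra_simps)
    also have "\<dots> \<le> levy_mass j \<gamma> l * 2"
      using levy_mass_pos[OF \<gamma>, of j l] y12 by (intro mult_left_mono) auto
    finally show ?thesis by simp
  qed
  ultimately have "\<bar>t\<bar> / 2 * (1 - cos 1) \<le> levy_mass j \<gamma> l * (1 - cos y)"
    by (intro mult_mono) (auto intro: order_trans[rotated])
  moreover have "cos (t * levy_atom j \<gamma> l) = cos y"
    unfolding y_def by (cases "t \<ge> 0") (auto simp: abs_if)
  ultimately show ?thesis
    using Re_levy_exponent_le[OF \<gamma>, of j t l] by (simp add: algebra_simps)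
qed

text \<open>The exponential decay is weakened to a multiple of the integrable function
  \<open>1 / (1 + t^2)\<close>. The threshold \<open>t0\<close> is where the largest atom starts to
  satisfy the hypothesis of \<open>Re_levy_exponent_linear\<close>.\<close>

lemma norm_char_W_law_le:
  assumes \<gamma>: "\<gamma> > 0"
  shows "\<exists>C. \<forall>t. norm (char (W_law j \<gamma>) t) \<le> C / (1 + t\<^sup>2)"
proof -
  define t0 where "t0 = 1 / levy_atom j \<gamma> 0"
  \<comment> \<open>\<open>exp (- s) \<le> 2 / s^2\<close> with
    \<open>s = (1 - cos 1) * \<bar>t\<bar> / 2\<close> reads \<open>c / t^2\<close>.\<close>
  define c where "c = 8 / (1 - cos 1 :: real)\<^sup>2"
  have t0: "t0 > 0" using levy_atom_pos[OF \<gamma>] by (simp add: t0_def)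
  have cos1: "cos 1 < (1::real)"
    using cos_monotone_0_pi[of 0 1] pi_gt3 by simp
  then have c: "c > 0" by (simp add: c_def)
  \<comment> \<open>The first summand serves \<open>\<bar>t\<bar> < t0\<close>, where the modulus is
    just bounded by 1, the second the remaining \<open>t\<close>.\<close>
  define C where "C = (1 + t0\<^sup>2) + c * (1 + 1 / t0\<^sup>2)"
  have "norm (char (W_law j \<gamma>) t) \<le> C / (1 + t\<^sup>2)" for t
  proof -
    have n: "norm (char (W_law j \<gamma>) t) = exp (Re (levy_exponent j \<gamma> t))"
      by (simp add: char_W_law[OF \<gamma>])
    have "exp (Re (levy_exponent j \<gamma> t)) * (1 + t\<^sup>2) \<le> C"
    proof (cases "\<bar>t\<bar> < t0")
      case True
      then have "t\<^sup>2 \<le> t0\<^sup>2" by (metis abs_ge_zero less_imp_le power2_abs power_mono)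
      moreover have "exp (Re (levy_exponent j \<gamma> t)) \<le> 1"
        using Re_levy_exponent_nonpos[OF \<gamma>] by simp
      ultimately have "exp (Re (levy_exponent j \<gamma> t)) * (1 + t\<^sup>2) \<le> 1 * (1 + t0\<^sup>2)"
        by (intro mult_mono) auto
      also have "\<dots> \<le> C" using c by (simp add: C_def)
      finally show ?thesis .
    next
      case False
      define s where "s = (1 - cos 1) * \<bar>t\<bar> / 2"
      have s: "s > 0" using False t0 cos1 by (simp add: s_def)
      have "1 \<le> \<bar>t\<bar> * levy_atom j \<gamma> 0"
        using False levy_atom_pos[OF \<gamma>, of j 0] by (simp add: t0_def field_simps)
      from Re_levy_exponent_linear[OF \<gamma> this] have "exp (Re (levy_exponent j \<gamma> t)) \<le> exp (- s)"
        by (simp add: s_def)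
      also have "\<dots> = 1 / exp s" by (simp add: exp_minus field_simps)
      also have "\<dots> \<le> 1 / (s\<^sup>2 / 2)"
        using exp_lower_Taylor_quadratic[of s] s by (intro divide_left_mono) auto
      also have "\<dots> = c / t\<^sup>2"
        by (simp add: s_def c_def power_mult_distrib power_divide)
      finally have "exp (Re (levy_exponent j \<gamma> t)) * (1 + t\<^sup>2) \<le> c / t\<^sup>2 * (1 + t\<^sup>2)"
        by (intro mult_right_mono) auto
      also have "\<dots> = c * (1 + 1 / t\<^sup>2)"
        using False t0 by (simp add: field_simps)
      also have "\<dots> \<le> c * (1 + 1 / t0\<^sup>2)"
      proof -
        have "t0\<^sup>2 \<le> t\<^sup>2" using False t0 by (metis less_imp_le not_less power2_abs power_mono)
        moreover have "0 < t\<^sup>2" using False t0 by simp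
        ultimately show ?thesis using c t0 by (intro mult_left_mono add_left_mono divide_left_mono) auto
      qed
      also have "\<dots> \<le> C" by (simp add: C_def)
      finally show ?thesis .
    qed
    moreover have "0 < 1 + t\<^sup>2" by (simp add: add_pos_nonneg)
    ultimately show ?thesis unfolding n by (simp add: pos_le_divide_eq)
  qed
  then show ?thesis by blast
qed

text \<open>The kernel of the inversion formula is bounded by \<open>b - a\<close>, so an integrable
  characteristic function forces the mass of an interval to be of the order of its length.\<close>

lemma (in real_distribution) no_atoms_if_char_decay:
  assumes C: "\<And>t. norm (char M t) \<le> C / (1 + t\<^sup>2)"
  shows "measure M {x} = 0"
proof -
  have int: "integrable lborel (\<lambda>t::real. inverse (1 + t\<^sup>2))"
    using integrable_inverse_1_plus_square by (simp add: set_integrable_def)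
  define I where "I = integral\<^sup>L lborel (\<lambda>t::real. inverse (1 + t\<^sup>2))"
  have C0: "0 \<le> C" using C[of 0] norm_ge_zero[of "char M 0"] by (simp del: norm_ge_zero)
  have Ioc: "measure M {a<..b} \<le> C * I * (b - a)"
    if ab: "a \<le> b" "measure M {a} = 0" "measure M {b} = 0" for a b
  proof (rule tendsto_upperbound)
    let ?f = "\<lambda>t. (iexp (-(t * a)) - iexp (-(t * b))) / (\<i> * t) * char M t"
    have bound: "norm (?f t) \<le> C * (b - a) * inverse (1 + t\<^sup>2)" for t
    proof (cases "t = 0")
      case False
      have "norm ((iexp (-(t * a)) - iexp (-(t * b))) / (\<i> * t)) \<le> b - a"
        using Levy_Inversion_aux2[of a b "- t"] ab(1) False
        by (simp add: norm_divide norm_minus_commute)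
      then have "norm (?f t) \<le> (b - a) * (C / (1 + t\<^sup>2))"
        unfolding norm_mult using C by (intro mult_mono) (use ab in auto)
      then show ?thesis by (simp add: divide_inverse mult_ac)
    qed (use C0 ab in simp)
    have CL: "norm (CLBINT t=-T..T. ?f t) \<le> C * (b - a) * I" if "T \<ge> 0" for T :: real
    proof -
      have "(CLBINT t=-T..T. ?f t) = (\<integral>t. indicator {-T<..<T} t *\<^sub>R ?f t \<partial>lborel)"
        using that by (simp add: interval_lebesgue_integral_def set_lebesgue_integral_def einterval_eq)
      also have "norm \<dots> \<le> (\<integral>t. norm (indicator {-T<..<T} t *\<^sub>R ?f t) \<partial>lborel)"
        by (rule integral_norm_bound)
      also have "\<dots> \<le> (\<integral>t. C * (b - a) * inverse (1 + t\<^sup>2) \<partial>lborel)"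
      proof (rule integral_mono')
        show "norm (indicator {-T<..<T} t *\<^sub>R ?f t) \<le> C * (b - a) * inverse (1 + t\<^sup>2)" for t
          using bound[of t] order_trans[OF norm_ge_zero bound[of t]] by (auto simp: indicator_def)
        show "0 \<le> C * (b - a) * inverse (1 + t\<^sup>2)" for t
          by (rule order_trans[OF norm_ge_zero bound[of t]])
      qed (use int in auto)
      also have "\<dots> = C * (b - a) * I" by (simp add: I_def)
      finally show ?thesis .
    qed
    show "\<forall>\<^sub>F T::nat in sequentially. norm (1 / (2 * pi) * (CLBINT t=-(real T)..real T. ?f t)) \<le> C * I * (b - a)"
    proof (intro always_eventually allI)
      fix T :: nat
      have "norm (1 / (2 * pi) * (CLBINT t=-(real T)..real T. ?f t)) = 1 / (2 * pi) * norm (CLBINT t=-(real T)..real T. ?f t)"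
        by (simp add: norm_mult norm_divide)
      also have "\<dots> \<le> 1 * norm (CLBINT t=-(real T)..real T. ?f t)"
        using pi_gt3 by (intro mult_right_mono) auto
      also have "\<dots> \<le> C * I * (b - a)" 
        using CL[of "real T"] by (simp add: mult_ac)
      finally show "norm (1 / (2 * pi) * (CLBINT t=-(real T)..real T. ?f t)) \<le> C * I * (b - a)" .
    qed
    have "(\<lambda>T::nat. 1 / (2 * pi) * (CLBINT t=-(real T)..real T. ?f t)) \<longlonglongrightarrow> of_real (measure M {a<..b})"
      using Levy_Inversion[OF ab] by simp
    from tendsto_norm[OF this]
    show "(\<lambda>T::nat. norm (1 / (2 * pi) * (CLBINT t=-(real T)..real T. ?f t))) \<longlonglongrightarrow> measure M {a<..b}" by simp
  qed simp
  \<comment> \<open>The inversion formula needs endpoints without mass. Only countably many points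
    carry mass, so admissible endpoints exist arbitrarily close to \<open>x\<close>.\<close>
  have count: "countable {x. measure M {x} \<noteq> 0}" by (rule countable_support)
  have small: "measure M {x} \<le> C * I * (2 * d)" if d: "d > 0" for d
  proof -
    obtain a where a: "x - d < a" "a < x" "measure M {a} = 0"
      using real_interval_avoid_countable_set[of "x - d" x, OF _ count] d by auto
    obtain b where b: "x < b" "b < x + d" "measure M {b} = 0"
      using real_interval_avoid_countable_set[of x "x + d", OF _ count] d by auto
    have I_nonneg: "0 \<le> I" unfolding I_def by (intro integral_nonneg_AE) auto
    have "measure M {x} \<le> measure M {a<..b}"
      using a b by (intro finite_measure_mono) auto
    also have "\<dots> \<le> C * I * (b - a)" using a b by (intro Ioc) auto
    also have "\<dots> \<le> C * I * (2 * d)" using a b C0 I_nonneg by (intro mult_left_mono) auto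
    finally show ?thesis .
  qed
  have "((\<lambda>d. C * I * (2 * d)) \<longlongrightarrow> C * I * (2 * 0)) (at_right 0)"
    by (intro tendsto_intros)
  then have "measure M {x} \<le> C * I * (2 * 0)"
    by (rule tendsto_lowerbound) (auto simp: eventually_at_filter small)
  then show ?thesis by (simp add: measure_le_0_iff)
qed

lemma W_law_no_atoms: "\<gamma> > 0 \<Longrightarrow> measure (W_law j \<gamma>) {x} = 0"
  using norm_char_W_law_le[of \<gamma> j]
    real_distribution.no_atoms_if_char_decay[OF real_distribution_W_law[of \<gamma> j]] by blast

section \<open>Dependence on the parameter; uniformity of weak convergence\<close>

text \<open>Tannery's theorem: as \<open>1 / \<gamma> \<le> 2\<close>, the bound of
  \<open>norm_levy_term\<close> has the geometric majorant \<open>B\<close>, common to all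
  parameters.\<close>

lemma tendsto_levy_exponent:
  fixes g :: "nat \<Rightarrow> real"
  assumes g: "g \<longlonglongrightarrow> \<gamma>" and ge: "\<And>n. g n \<ge> 1 / 2" and \<gamma>: "\<gamma> \<ge> 1 / 2"
  shows "(\<lambda>n. levy_exponent j (g n) t) \<longlonglongrightarrow> levy_exponent j \<gamma> t"
proof -
  define B where "B l = t\<^sup>2 * 2 powr real_of_int j * (1 / 2) ^ l" for l :: nat
  have "summable B" unfolding B_def by (intro summable_mult summable_geometric) simp
  have terms: "(\<lambda>n. levy_term j (g n) t l) \<longlonglongrightarrow> levy_term j \<gamma> t l" for l
    unfolding levy_term_def levy_mass_def levy_atom_def using \<gamma> g by (intro tendsto_intros) auto
  have bound: "norm (levy_term j (g n) t l) \<le> B l" for n l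
  proof -
    have "norm (levy_term j (g n) t l) \<le> t\<^sup>2 / 2 * levy_atom j (g n) l"
      using ge[of n] by (intro norm_levy_term) simp
    also have "\<dots> = t\<^sup>2 * 2 powr real_of_int j * (1 / 2) ^ l * (1 / (2 * g n))"
      by (simp add: levy_atom_def)
    also have "\<dots> \<le> t\<^sup>2 * 2 powr real_of_int j * (1 / 2) ^ l * 1"
      using ge[of n] by (intro mult_left_mono) (auto simp: field_simps)
    finally show ?thesis by (simp add: B_def)
  qed
  have "\<forall>\<^sub>F (l, n) in at_top \<times>\<^sub>F sequentially. norm (levy_term j (g n) t l) \<le> B l"
    using bound by (intro always_eventually) auto
  from tannerys_theorem[OF terms this \<open>summable B\<close>]
  have "(\<lambda>n. \<Sum>l. levy_term j (g n) t l) \<longlonglongrightarrow> (\<Sum>l. levy_term j \<gamma> t l)"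
    by simp
  then show ?thesis unfolding levy_exponent_def using g \<gamma> ge
    by (intro tendsto_intros) auto
qed

text \<open>Polya's theorem. Monotonicity reduces uniformity to finitely many points: a grid on
  \<open>[-A, A]\<close> so fine that the continuous limit varies by less than \<open>e\<close> in
  each cell, with tails below \<open>e\<close> outside.\<close>

lemma weak_conv_uniform_cdf:
  assumes M: "\<And>n. real_distribution (M n)" and H: "real_distribution H"
    and weak: "weak_conv_m M H" and cont: "\<And>x. measure H {x} = 0" and \<epsilon>: "\<epsilon> > 0"
  shows "\<forall>\<^sub>F n in sequentially. \<forall>x. \<bar>cdf (M n) x - cdf H x\<bar> \<le> \<epsilon>"
proof -
  interpret H: real_distribution H by fact
  interpret M: real_distribution "M n" for n by (rule M)
  have isCont: "isCont (cdf H) x" for x using H.isCont_cdf cont by simp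
  have lim: "(\<lambda>n. cdf (M n) x) \<longlonglongrightarrow> cdf H x" for x
    using weak isCont by (simp add: weak_conv_m_def weak_conv_def)
  define e where "e = \<epsilon> / 3"
  have e: "e > 0" using \<epsilon> by (simp add: e_def)
  obtain A where A: "A > 0" "cdf H (- A) < e" "cdf H A > 1 - e"
  proof -
    have "\<forall>\<^sub>F k in sequentially. cdf H (- real k) < e"
      using H.cdf_lim_neg_infty e by (rule order_tendstoD)
    moreover have "\<forall>\<^sub>F k in sequentially. cdf H (real k) > 1 - e"
      using H.cdf_lim_infty_prob e by (intro order_tendstoD(1)) auto
    moreover have "\<forall>\<^sub>F k in sequentially. k > (0::nat)" by (rule eventually_gt_at_top)
    ultimately have "\<forall>\<^sub>F k in sequentially. cdf H (- real k) < e \<and> cdf H (real k) > 1 - e \<and> k > 0"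
      by eventually_elim auto
    then obtain k :: nat where "cdf H (- real k) < e \<and> cdf H (real k) > 1 - e \<and> k > 0"
      by (auto simp: eventually_sequentially)
    then show ?thesis using that[of "real k"] by auto
  qed
  have "uniformly_continuous_on {-A..A} (cdf H)"
    using isCont by (intro compact_uniformly_continuous continuous_at_imp_continuous_on) auto
  then obtain d where d: "d > 0"
    "\<And>x y. x \<in> {-A..A} \<Longrightarrow> y \<in> {-A..A} \<Longrightarrow> dist y x < d \<Longrightarrow> dist (cdf H y) (cdf H x) < e"
    using e unfolding uniformly_continuous_on_def by metis
  obtain m :: nat where m: "2 * A / d < real m" using reals_Archimedean2 by blast
  have m0: "m > 0" using m A(1) d(1) by (cases m) (auto simp: field_simps)
  define h where "h = 2 * A / real m"
  have h: "0 < h" "h < d" using m A(1) d(1) m0 by (auto simp: h_def field_simps)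
  define y where "y i = - A + real i * h" for i :: nat
  have y0: "y 0 = - A" and ym: "y m = A" using m0 by (auto simp: y_def h_def)
  have "\<forall>\<^sub>F n in sequentially. \<forall>i\<in>{..m}. \<bar>cdf (M n) (y i) - cdf H (y i)\<bar> < e"
  proof (intro eventually_ball_finite ballI)
    fix i assume "i \<in> {..m}"
    show "\<forall>\<^sub>F n in sequentially. \<bar>cdf (M n) (y i) - cdf H (y i)\<bar> < e"
      using tendstoD[OF lim e] by (simp add: dist_real_def)
  qed simp
  then show ?thesis
  proof eventually_elim
    case (elim n)
    have mono: "u \<le> v \<Longrightarrow> cdf H u \<le> cdf H v" "u \<le> v \<Longrightarrow> cdf (M n) u \<le> cdf (M n) v" for u v
      by (rule H.cdf_nondecreasing M.cdf_nondecreasing; assumption)+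
    have bd: "0 \<le> cdf H u" "cdf H u \<le> 1" "0 \<le> cdf (M n) u" "cdf (M n) u \<le> 1" for u
      by (rule H.cdf_nonneg H.cdf_bounded_prob M.cdf_nonneg M.cdf_bounded_prob)+
    have at: "\<bar>cdf (M n) (y i) - cdf H (y i)\<bar> < e" if "i \<le> m" for i using elim that by auto
    show ?case
    proof
      fix x
      consider "x \<le> - A" | "A \<le> x" | "- A < x" "x < A" by linarith
      then have "\<bar>cdf (M n) x - cdf H x\<bar> \<le> 3 * e"
      proof cases
        case 1
        then show ?thesis using mono[OF 1] at[of 0] A bd[of x] e unfolding y0 by auto
      next
        case 2
        then show ?thesis using mono[OF 2] at[of m] A bd[of x] e unfolding ym by auto
      next
        case 3
        define i where "i = nat \<lfloor>(x + A) / h\<rfloor>"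
        have "0 \<le> (x + A) / h" using 3 h by simp
        then have i: "real i \<le> (x + A) / h" "(x + A) / h < real i + 1"
          unfolding i_def by linarith+
        have "(x + A) / h < real m" using 3 h A m0 by (simp add: h_def field_simps)
        then have im: "Suc i \<le> m" using i by linarith
        have yi: "y i \<le> x" "x < y (Suc i)" using i h by (auto simp: y_def field_simps)
        have "y i \<in> {-A..A}" "y (Suc i) \<in> {-A..A}"
        proof -
          have "real (Suc i) * h \<le> real m * h" using im h by (intro mult_right_mono) auto
          then have "y (Suc i) \<le> A" using ym by (simp add: y_def)
          then show "y i \<in> {-A..A}" "y (Suc i) \<in> {-A..A}"
            using h yi 3 by (auto simp: y_def)
        qed
        moreover have "dist (y (Suc i)) (y i) < d" using h by (simp add: y_def dist_real_def algebra_simps)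
        ultimately have "dist (cdf H (y (Suc i))) (cdf H (y i)) < e" by (intro d(2)) auto
        then have "cdf H (y (Suc i)) - cdf H (y i) < e" by (simp add: dist_real_def)
        moreover have "cdf H (y i) \<le> cdf H x" "cdf H x \<le> cdf H (y (Suc i))"
          "cdf (M n) (y i) \<le> cdf (M n) x" "cdf (M n) x \<le> cdf (M n) (y (Suc i))"
          using yi by (auto intro: mono)
        ultimately show ?thesis using at[of i] at[of "Suc i"] im e by linarith
      qed
      then show "\<bar>cdf (M n) x - cdf H x\<bar> \<le> \<epsilon>" by (simp add: e_def)
    qed
  qed
qed

section \<open>The mixture law\<close>

lemma real_distribution_sets: "real_distribution \<mu> \<Longrightarrow> sets \<mu> = sets borel"
  by (simp add: real_distribution_def real_distribution_axioms_def)

lemma real_distribution_bind_pmf: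
  fixes P :: "'i pmf" and \<kappa> :: "'i \<Rightarrow> real measure"
  assumes \<kappa>: "\<And>i. real_distribution (\<kappa> i)"
  shows "real_distribution (measure_pmf P \<bind> \<kappa>)"
    and "A \<in> sets borel \<Longrightarrow> measure (measure_pmf P \<bind> \<kappa>) A = (\<integral>i. measure (\<kappa> i) A \<partial>measure_pmf P)"
    and "char (measure_pmf P \<bind> \<kappa>) t = (\<integral>i. char (\<kappa> i) t \<partial>measure_pmf P)"
proof -
  interpret \<kappa>: real_distribution "\<kappa> i" for i by (rule \<kappa>)
  have ks: "sets (\<kappa> i) = sets borel" for i by (rule real_distribution_sets[OF \<kappa>])
  have \<kappa>m: "\<kappa> \<in> measurable (measure_pmf P) (subprob_algebra borel)"
    using ks \<kappa>.prob_space_axioms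
    by (auto simp: space_subprob_algebra intro!: measurable_pmf_measure1 prob_space_imp_subprob_space)
  let ?H = "measure_pmf P \<bind> \<kappa>"
  have sH: "sets ?H = sets borel" using ks by (intro sets_bind) auto
  have "prob_space ?H"
    using \<kappa>.prob_space_axioms by (intro measure_pmf.prob_space_bind[OF _ \<kappa>m]) auto
  then show rd: "real_distribution ?H"
    using sH by (simp add: real_distribution_def real_distribution_axioms_def)
  then interpret H: real_distribution ?H .
  show "measure ?H A = (\<integral>i. measure (\<kappa> i) A \<partial>measure_pmf P)" if "A \<in> sets borel"
    using measure_pmf.measure_bind[OF \<kappa>m that] .
  have int: "(\<integral>x. f x \<partial>?H) = (\<integral>i. (\<integral>x. f x \<partial>\<kappa> i) \<partial>measure_pmf P)"
    if f[measurable]: "f \<in> borel_measurable borel" and bd: "\<And>x. \<bar>f x\<bar> \<le> 1" for f :: "real \<Rightarrow> real"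
  proof -
    let ?D = "distr (measure_pmf P) (subprob_algebra borel) \<kappa>"
    have "?H = join ?D" by (rule bind_nonempty''[OF \<kappa>m]) simp
    moreover have "integral\<^sup>L (join ?D) f = (\<integral>M'. integral\<^sup>L M' f \<partial>?D)"
    proof (rule integral_join[where B=1 and B'=1 and N=borel])
      show "finite_measure ?D"
        using \<kappa>m by (intro finite_measure.finite_measure_distr) (auto intro: measure_pmf.finite_measure_axioms)
      show "AE M' in ?D. emeasure M' (space M') \<le> ennreal 1"
        by (rule AE_I2) (auto simp: space_subprob_algebra subprob_space.emeasure_space_le_1)
    qed (use bd in auto)
    moreover have "\<dots> = (\<integral>i. (\<integral>x. f x \<partial>\<kappa> i) \<partial>measure_pmf P)"
      by (rule integral_distr[OF \<kappa>m]) measurable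
    ultimately show ?thesis by simp
  qed
  have ic: "integrable (measure_pmf P) (\<lambda>i. char (\<kappa> i) t)"
    by (rule measure_pmf.integrable_const_bound[where B=1]) (auto simp: \<kappa>.cmod_char_le_1)
  \<comment> \<open>\<open>int\<close> covers bounded real integrands, so the characteristic
    function is treated through cosine and sine.\<close>
  have Re: "Re (char \<mu> t) = (\<integral>x. cos (t * x) \<partial>\<mu>)" and Im: "Im (char \<mu> t) = (\<integral>x. sin (t * x) \<partial>\<mu>)"
    if "real_distribution \<mu>" for \<mu>
  proof -
    interpret real_distribution \<mu> by fact
    have "integrable \<mu> (\<lambda>x. iexp (t * x))" by (intro integrable_iexp) auto
    from integral_Re[OF this] integral_Im[OF this]
    show "Re (char \<mu> t) = (\<integral>x. cos (t * x) \<partial>\<mu>)" "Im (char \<mu> t) = (\<integral>x. sin (t * x) \<partial>\<mu>)"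
      by (simp_all add: char_def Re_exp Im_exp)
  qed
  show "char ?H t = (\<integral>i. char (\<kappa> i) t \<partial>measure_pmf P)"
  proof (rule complex_eqI)
    show "Re (char ?H t) = Re (\<integral>i. char (\<kappa> i) t \<partial>measure_pmf P)"
      using Re[OF rd] Re[OF \<kappa>] integral_Re[OF ic] int[of "\<lambda>x. cos (t * x)"] by simp
    show "Im (char ?H t) = Im (\<integral>i. char (\<kappa> i) t \<partial>measure_pmf P)"
      using Im[OF rd] Im[OF \<kappa>] integral_Im[OF ic] int[of "\<lambda>x. sin (t * x)"] by simp
  qed
qed

text \<open>Bridges two notions of sum: mixture probabilities are expectations, whereas
  \<open>Gstar\<close> is an unordered sum. Boundedness yields absolute summability, under which
  both agree.\<close>

lemma has_sum_expectation_pmf: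
  fixes f :: "'i \<Rightarrow> real"
  assumes "\<And>i. \<bar>f i\<bar> \<le> B"
  shows "((\<lambda>i. f i * pmf P i) has_sum (\<integral>i. f i \<partial>measure_pmf P)) UNIV"
proof -
  have i: "integrable (measure_pmf P) f"
    using assms by (intro measure_pmf.integrable_const_bound[where B=B]) auto
  then have "integrable (count_space UNIV) (\<lambda>i. pmf P i *\<^sub>R f i)"
    unfolding measure_pmf_eq_density by (subst (asm) integrable_density) auto
  then have abs: "Infinite_Set_Sum.abs_summable_on (\<lambda>i. f i * pmf P i) UNIV"
    by (simp add: Infinite_Set_Sum.abs_summable_on_def mult.commute)
  have eq: "infsetsum (\<lambda>i. f i * pmf P i) UNIV = infsum (\<lambda>i. f i * pmf P i) UNIV"
    by (rule infsetsum_infsum[OF abs])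
  have "((\<lambda>i. f i * pmf P i) has_sum infsum (\<lambda>i. f i * pmf P i) UNIV) UNIV"
    by (rule has_sum_infsum[OF abs_summable_summable[OF abs_summable_equivalent[THEN iffD2, OF abs]]])
  moreover have "(\<integral>i. f i \<partial>measure_pmf P) = (\<integral>i. pmf P i *\<^sub>R f i \<partial>count_space UNIV)"
    unfolding measure_pmf_eq_density by (rule integral_density) auto
  then have "(\<integral>i. f i \<partial>measure_pmf P) = infsetsum (\<lambda>i. f i * pmf P i) UNIV"
    by (simp add: infsetsum_def mult.commute)
  ultimately show ?thesis using eq by simp
qed

lemma norm_expectation_pmf_truncate:
  fixes h :: "'i \<Rightarrow> complex"
  assumes h: "\<And>i. norm (h i) \<le> 1" and A: "finite A"
  shows "norm ((\<integral>i. h i \<partial>measure_pmf P) - (\<Sum>i\<in>A. of_real (pmf P i) * h i)) \<le> 1 - (\<Sum>i\<in>A. pmf P i)"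
proof -
  have ih: "integrable (measure_pmf P) h"
    using h by (intro measure_pmf.integrable_const_bound[where B=1]) auto
  have iA: "integrable (measure_pmf P) (\<lambda>i. indicator A i *\<^sub>R h i)"
    using h by (intro measure_pmf.integrable_const_bound[where B=1]) (auto simp: indicator_def)
  have "(\<integral>i. indicator A i *\<^sub>R h i \<partial>measure_pmf P) = (\<Sum>i\<in>A. pmf P i *\<^sub>R (indicator A i *\<^sub>R h i))"
    by (rule integral_measure_pmf[OF A]) (auto simp: indicator_def split: if_splits)
  also have "\<dots> = (\<Sum>i\<in>A. of_real (pmf P i) * h i)"
    by (intro sum.cong) (auto simp: scaleR_conv_of_real)
  finally have "(\<integral>i. h i \<partial>measure_pmf P) - (\<Sum>i\<in>A. of_real (pmf P i) * h i)
      = (\<integral>i. h i - indicator A i *\<^sub>R h i \<partial>measure_pmf P)"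
    using ih iA by simp
  also have "norm \<dots> \<le> (\<integral>i. norm (h i - indicator A i *\<^sub>R h i) \<partial>measure_pmf P)"
    by (rule integral_norm_bound)
  also have "\<dots> \<le> (\<integral>i. indicator (- A) i \<partial>measure_pmf P)"
    using h by (intro integral_mono) (auto simp: indicator_def intro!: measure_pmf.integrable_const_bound[where B=1])
  also have "\<dots> = measure (measure_pmf P) (- A)" by simp
  also have "\<dots> = 1 - measure (measure_pmf P) A"
    using measure_pmf.prob_compl[of A P] by (simp add: Compl_eq_Diff_UNIV)
  also have "measure (measure_pmf P) A = (\<Sum>i\<in>A. pmf P i)"
    by (rule measure_measure_pmf_finite[OF A])
  finally show ?thesis .
qed

text \<open>Squaring \<open>exp (- \<gamma> 2^(-j))\<close> lowers \<open>j\<close> by one. The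
  difference is the limiting form of the probability that the maximum is at most \<open>2^K\<close>
  but not at most \<open>2^(K-1)\<close>, and it makes the weights telescope.\<close>

lemma p_jg_eq_diff: "p_jg j \<gamma> = exp (- \<gamma> * 2 powr (- real_of_int j)) - exp (- \<gamma> * 2 powr (- real_of_int (j - 1)))"
proof -
  have "2 powr (- real_of_int (j - 1)) = 2 * 2 powr (- real_of_int j)"
    by (simp add: powr_diff powr_minus field_simps)
  then have "exp (- \<gamma> * 2 powr (- real_of_int (j - 1))) = exp (- \<gamma> * 2 powr (- real_of_int j) + - \<gamma> * 2 powr (- real_of_int j))"
    by simp
  then show ?thesis unfolding p_jg_def by (simp only: exp_add) (simp add: algebra_simps)
qed

lemma p_jg_nonneg: "\<gamma> > 0 \<Longrightarrow> p_jg j \<gamma> \<ge> 0"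
  by (simp add: p_jg_def)

lemma sum_telescope_sym_int:
  fixes f :: "int \<Rightarrow> 'a :: ab_group_add"
  shows "(\<Sum>j\<in>{- int J..int J}. f j - f (j - 1)) = f (int J) - f (- int J - 1)"
proof (induction J)
  case (Suc J)
  define a where "a = int J + 1"
  define b where "b = - int J - 1"
  have "{- int (Suc J)..int (Suc J)} = insert a (insert b {- int J..int J})"
    by (auto simp: a_def b_def)
  moreover have "a \<notin> insert b {- int J..int J}" "b \<notin> {- int J..int J}"
    by (auto simp: a_def b_def)
  ultimately have "(\<Sum>j\<in>{- int (Suc J)..int (Suc J)}. f j - f (j - 1))
      = (f a - f (a - 1)) + ((f b - f (b - 1)) + (f (int J) - f (- int J - 1)))"
    using Suc by simp
  moreover have "int J = a - 1" "int (Suc J) = a" "- int J - 1 = b" "- int (Suc J) - 1 = b - 1"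
    by (auto simp: a_def b_def)
  ultimately show ?case by simp
qed simp

lemma sum_p_jg:
  "(\<Sum>j\<in>{- int J..int J}. p_jg j \<gamma>) = exp (- \<gamma> / 2 ^ J) - exp (- \<gamma> * 2 ^ Suc J)"
proof -
  have "2 powr (- real_of_int (int J)) = (1::real) / 2 ^ J"
    by (simp add: powr_minus powr_realpow divide_inverse)
  \<comment> \<open>The telescoping sum over \<open>-J..J\<close> ends at \<open>- J - 1\<close>,
    hence the exponent \<open>Suc J\<close>.\<close>
  moreover have "2 powr (- real_of_int (- int J - 1)) = (2::real) ^ Suc J"
  proof -
    have "- real_of_int (- int J - 1) = real (Suc J)" by simp
    then show ?thesis by (simp only: powr_realpow)
  qed
  ultimately show ?thesis
    using sum_telescope_sym_int[of "\<lambda>j. exp (- \<gamma> * 2 powr (- real_of_int j))" J]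
    by (simp only: p_jg_eq_diff) simp
qed

lemma nn_integral_p_jg:
  assumes \<gamma>: "\<gamma> > 0"
  shows "(\<integral>\<^sup>+j. ennreal (p_jg j \<gamma>) \<partial>count_space UNIV) = 1"
proof -
  let ?f = "\<lambda>J j. ennreal (p_jg j \<gamma>) * indicator {- int J..int J} j"
  have "(\<lambda>J. \<integral>\<^sup>+j. ?f J j \<partial>count_space UNIV) \<longlonglongrightarrow> (\<integral>\<^sup>+j. ennreal (p_jg j \<gamma>) \<partial>count_space UNIV)"
  proof (rule nn_integral_LIMSEQ)
    show "incseq ?f" by (auto simp: incseq_def le_fun_def indicator_def)
    show "(\<lambda>J. ?f J j) \<longlonglongrightarrow> ennreal (p_jg j \<gamma>)" for j
    proof (rule tendsto_eventually)
      show "\<forall>\<^sub>F J in sequentially. ?f J j = ennreal (p_jg j \<gamma>)"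
        using eventually_ge_at_top[of "nat \<bar>j\<bar>"] by eventually_elim (auto simp: indicator_def)
    qed
  qed simp
  moreover have "(\<integral>\<^sup>+j. ?f J j \<partial>count_space UNIV) = ennreal (exp (- \<gamma> / 2 ^ J) - exp (- \<gamma> * 2 ^ Suc J))" for J
  proof -
    have "(\<integral>\<^sup>+j. ?f J j \<partial>count_space UNIV) = (\<Sum>j\<in>{- int J..int J}. ennreal (p_jg j \<gamma>))"
      by (subst nn_integral_indicator_finite) auto
    also have "\<dots> = ennreal (\<Sum>j\<in>{- int J..int J}. p_jg j \<gamma>)"
      using p_jg_nonneg[OF \<gamma>] by (intro sum_ennreal)
    finally show ?thesis by (simp only: sum_p_jg)
  qed
  moreover have "(\<lambda>J. ennreal (exp (- \<gamma> / 2 ^ J) - exp (- \<gamma> * 2 ^ Suc J))) \<longlonglongrightarrow> ennreal 1"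
  proof (rule tendsto_ennrealI)
    have "(\<lambda>J. exp (- \<gamma> / 2 ^ J) - exp (- \<gamma> * 2 ^ Suc J)) \<longlonglongrightarrow> exp 0 - 0"
    proof (rule tendsto_diff)
      have "(\<lambda>J. - \<gamma> * (1 / 2) ^ J) \<longlonglongrightarrow> - \<gamma> * 0"
        by (intro tendsto_intros LIMSEQ_realpow_zero) auto
      then show "(\<lambda>J. exp (- \<gamma> / 2 ^ J)) \<longlonglongrightarrow> exp 0"
        by (intro tendsto_exp) (simp add: power_divide)
      show "(\<lambda>J. exp (- \<gamma> * 2 ^ Suc J)) \<longlonglongrightarrow> 0"
        using \<gamma> by real_asymp
    qed
    then show "(\<lambda>J. exp (- \<gamma> / 2 ^ J) - exp (- \<gamma> * 2 ^ Suc J)) \<longlonglongrightarrow> 1" by simp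
  qed
  ultimately have "(\<lambda>J. ennreal (exp (- \<gamma> / 2 ^ J) - exp (- \<gamma> * 2 ^ Suc J)))
    \<longlonglongrightarrow> (\<integral>\<^sup>+j. ennreal (p_jg j \<gamma>) \<partial>count_space UNIV)" by simp
  then show ?thesis
    using LIMSEQ_unique[OF _ \<open>(\<lambda>J. ennreal (exp (- \<gamma> / 2 ^ J) - exp (- \<gamma> * 2 ^ Suc J))) \<longlonglongrightarrow> ennreal 1\<close>]
    by simp
qed

definition max_index_pmf :: "real \<Rightarrow> int pmf" where
  "max_index_pmf \<gamma> = embed_pmf (\<lambda>j. p_jg j \<gamma>)"

lemma pmf_max_index: "\<gamma> > 0 \<Longrightarrow> pmf (max_index_pmf \<gamma>) j = p_jg j \<gamma>"
  unfolding max_index_pmf_def using p_jg_nonneg nn_integral_p_jg by (intro pmf_embed_pmf) auto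

text \<open>The number of observations attaining a maximum at level \<open>j\<close>. The value at 0
  is set by hand because the formula of \<open>r_jg\<close> does not vanish there.\<close>

definition ties_pmf :: "int \<Rightarrow> real \<Rightarrow> nat pmf" where
  "ties_pmf j \<gamma> = embed_pmf (\<lambda>m. if m = 0 then 0 else r_jg j \<gamma> m)"

lemma r_jg_eq_mass: "r_jg j \<gamma> m = levy_mass j \<gamma> 0 ^ m / fact m / (exp (levy_mass j \<gamma> 0) - 1)"
  by (simp add: r_jg_def levy_mass_def mult.commute)

lemma pmf_ties:
  assumes \<gamma>: "\<gamma> > 0"
  shows "pmf (ties_pmf j \<gamma>) m = (if m = 0 then 0 else r_jg j \<gamma> m)"
  unfolding ties_pmf_def
proof (rule pmf_embed_pmf)
  define s where "s = levy_mass j \<gamma> 0"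
  have s: "s > 0" using levy_mass_pos[OF \<gamma>] by (simp add: s_def)
  have e: "exp s - 1 > 0" using s by simp
  show nonneg: "0 \<le> (if x = 0 then 0 else r_jg j \<gamma> x)" for x
    using s e unfolding r_jg_eq_mass s_def[symmetric] by simp
  have "(\<lambda>m. s ^ m / fact m - (if m = 0 then 1 else 0)) sums (exp s - 1)"
    by (intro sums_diff poisson_series sums_single)
  then have "(\<lambda>m. (s ^ m / fact m - (if m = 0 then 1 else 0)) / (exp s - 1)) sums ((exp s - 1) / (exp s - 1))"
    by (rule sums_divide)
  also have "(\<lambda>m. (s ^ m / fact m - (if m = 0 then 1 else 0)) / (exp s - 1)) = (\<lambda>m. if m = 0 then 0 else r_jg j \<gamma> m)"
    by (auto simp: r_jg_eq_mass s_def)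
  finally have "(\<lambda>m. if m = 0 then 0 else r_jg j \<gamma> m) sums 1" using e by simp
  then show "(\<integral>\<^sup>+m. ennreal (if m = 0 then 0 else r_jg j \<gamma> m) \<partial>count_space UNIV) = 1"
    unfolding nn_integral_count_space_nat using nonneg
    by (subst suminf_ennreal2) (auto simp: sums_iff)
qed

text \<open>The limit given a maximum at level \<open>j\<close> with \<open>m\<close> ties: the
  smaller observations give \<open>W_law (j - 1) \<gamma>\<close>, and removing one maximum leaves
  \<open>m - 1\<close> copies of \<open>2^j / \<gamma>\<close>.\<close>

definition component_law :: "int \<Rightarrow> real \<Rightarrow> nat \<Rightarrow> real measure" where
  "component_law j \<gamma> m = distr (W_law (j - 1) \<gamma>) borel (\<lambda>x. x + (real m - 1) * 2 powr real_of_int j / \<gamma>)"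

definition max_law :: "int \<Rightarrow> real \<Rightarrow> real measure" where
  "max_law j \<gamma> = measure_pmf (ties_pmf j \<gamma>) \<bind> component_law j \<gamma>"

definition Gstar_law :: "real \<Rightarrow> real measure" where
  "Gstar_law \<gamma> = measure_pmf (max_index_pmf \<gamma>) \<bind> (\<lambda>j. max_law j \<gamma>)"

lemma real_distribution_component_law: "\<gamma> > 0 \<Longrightarrow> real_distribution (component_law j \<gamma> m)"
  unfolding component_law_def
  by (intro prob_space.real_distribution_distr)
     (auto intro: real_distribution.axioms real_distribution_W_law
       simp: real_distribution_sets[OF real_distribution_W_law] cong: measurable_cong_sets)

lemma real_distribution_max_law: "\<gamma> > 0 \<Longrightarrow> real_distribution (max_law j \<gamma>)"
  unfolding max_law_def by (intro real_distribution_bind_pmf real_distribution_component_law)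

lemma real_distribution_Gstar_law: "\<gamma> > 0 \<Longrightarrow> real_distribution (Gstar_law \<gamma>)"
  unfolding Gstar_law_def by (intro real_distribution_bind_pmf real_distribution_max_law)

lemma measure_component_law:
  assumes \<gamma>: "\<gamma> > 0" and [measurable]: "A \<in> sets borel"
  shows "measure (component_law j \<gamma> m) A
    = measure (W_law (j - 1) \<gamma>) ((\<lambda>x. x + (real m - 1) * 2 powr real_of_int j / \<gamma>) -` A)"
proof -
  interpret real_distribution "W_law (j - 1) \<gamma>" by (rule real_distribution_W_law[OF \<gamma>])
  show ?thesis unfolding component_law_def by (subst measure_distr) auto
qed

lemma Gstar_law_no_atoms:
  assumes \<gamma>: "\<gamma> > 0"
  shows "measure (Gstar_law \<gamma>) {x} = 0"
proof -
  have "(\<lambda>y. y + c) -` {x} = {x - c}" for c :: real by auto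
  then have "measure (component_law j \<gamma> m) {x} = 0" for j m
    by (simp add: measure_component_law[OF \<gamma>] W_law_no_atoms[OF \<gamma>])
  then have "measure (max_law j \<gamma>) {x} = 0" for j
    unfolding max_law_def by (subst real_distribution_bind_pmf) (auto intro: real_distribution_component_law[OF \<gamma>])
  then show ?thesis
    unfolding Gstar_law_def by (subst real_distribution_bind_pmf) (auto intro: real_distribution_max_law[OF \<gamma>])
qed

text \<open>The two stages of the mixture give iterated sums, over \<open>m\<close> inside and
  \<open>j\<close> outside; nonnegative terms turn them into the unordered sum over pairs.\<close>

lemma Gstar_eq_cdf:
  assumes \<gamma>: "\<gamma> > 0"
  shows "Gstar \<gamma> x = cdf (Gstar_law \<gamma>) x"
proof -
  note rd = real_distribution_W_law[OF \<gamma>] real_distribution_component_law[OF \<gamma>]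
    real_distribution_max_law[OF \<gamma>] real_distribution_Gstar_law[OF \<gamma>]
  have bd: "\<bar>cdf \<mu> x\<bar> \<le> 1" if "real_distribution \<mu>" for \<mu>
    using that finite_borel_measure.cdf_nonneg[of \<mu> x] real_distribution.cdf_bounded_prob[of \<mu> x]
    by (simp add: real_distribution.finite_borel_measure_M)
  let ?f = "\<lambda>(j, m). G_jg (j - 1) \<gamma> (x - (real m - 1) * 2 powr (real_of_int j) / \<gamma>) * r_jg j \<gamma> m * p_jg j \<gamma>"
  have comp: "cdf (component_law j \<gamma> m) x = G_jg (j - 1) \<gamma> (x - (real m - 1) * 2 powr (real_of_int j) / \<gamma>)" for j m
  proof -
    have "(\<lambda>y. y + c) -` {..x} = {..x - c}" for c :: real by auto
    then show ?thesis by (simp add: cdf_def measure_component_law[OF \<gamma>] G_jg_def)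
  qed
  have inner: "((\<lambda>m. ?f (j, m)) has_sum (cdf (max_law j \<gamma>) x * p_jg j \<gamma>)) {1..}" for j
  proof -
    have "cdf (max_law j \<gamma>) x = (\<integral>m. cdf (component_law j \<gamma> m) x \<partial>measure_pmf (ties_pmf j \<gamma>))"
      unfolding cdf_def max_law_def by (subst real_distribution_bind_pmf) (auto intro: rd)
    then have "((\<lambda>m. cdf (component_law j \<gamma> m) x * pmf (ties_pmf j \<gamma>) m) has_sum cdf (max_law j \<gamma>) x) UNIV"
      using has_sum_expectation_pmf[of "\<lambda>m. cdf (component_law j \<gamma> m) x" 1 "ties_pmf j \<gamma>"] bd[OF rd(2)] by simp
    then have "((\<lambda>m. cdf (component_law j \<gamma> m) x * r_jg j \<gamma> m) has_sum cdf (max_law j \<gamma>) x) {1..}"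
      by (subst (asm) has_sum_cong_neutral[where T="{1..}" and g="\<lambda>m. cdf (component_law j \<gamma> m) x * r_jg j \<gamma> m"])
         (auto simp: pmf_ties[OF \<gamma>])
    from has_sum_cmult_left[OF this, of "p_jg j \<gamma>"] show ?thesis by (simp add: comp)
  qed
  have outer: "((\<lambda>j. cdf (max_law j \<gamma>) x * p_jg j \<gamma>) has_sum cdf (Gstar_law \<gamma>) x) UNIV"
  proof -
    have "cdf (Gstar_law \<gamma>) x = (\<integral>j. cdf (max_law j \<gamma>) x \<partial>measure_pmf (max_index_pmf \<gamma>))"
      unfolding cdf_def Gstar_law_def by (subst real_distribution_bind_pmf) (auto intro: rd)
    then show ?thesis
      using has_sum_expectation_pmf[of "\<lambda>j. cdf (max_law j \<gamma>) x" 1 "max_index_pmf \<gamma>"] bd[OF rd(3)]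
      by (simp add: pmf_max_index[OF \<gamma>])
  qed
  have "?f summable_on Sigma UNIV (\<lambda>_. {1..})"
  proof (rule summable_on_SigmaI[OF inner])
    show "(\<lambda>j. cdf (max_law j \<gamma>) x * p_jg j \<gamma>) summable_on UNIV"
      using outer by (auto simp: summable_on_def)
    fix j m assume "m \<in> {1::nat..}"
    have "0 \<le> G_jg (j - 1) \<gamma> y" for y unfolding G_jg_def cdf_def by simp
    moreover have "0 \<le> r_jg j \<gamma> m"
      using levy_mass_pos[OF \<gamma>, of j 0] by (simp add: r_jg_eq_mass)
    ultimately show "0 \<le> ?f (j, m)" using p_jg_nonneg[OF \<gamma>] by simp
  qed
  then have "(?f has_sum cdf (Gstar_law \<gamma>) x) (Sigma UNIV (\<lambda>_. {1..}))"
    by (intro has_sum_SigmaI[OF inner outer])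
  then show ?thesis unfolding Gstar_def by (simp add: infsumI)
qed

section \<open>The characteristic function of the mixture\<close>

text \<open>The limiting counterpart of \<open>a_K^n\<close> with centering. It is defective: its
  value at 0 is the limiting probability that the maximum is at most level \<open>j\<close>.\<close>

definition psi :: "int \<Rightarrow> real \<Rightarrow> real \<Rightarrow> complex" where
  "psi j \<gamma> t = exp (levy_exponent j \<gamma> t - of_real (\<gamma> * 2 powr (- real_of_int j)))"

text \<open>Removes one copy of the maximum, whose rescaled size is
  \<open>2^K / n = 2^j / \<gamma>\<close>.\<close>

definition jump_factor :: "int \<Rightarrow> real \<Rightarrow> real \<Rightarrow> complex" where
  "jump_factor j \<gamma> t = iexp (- (t * (2 powr real_of_int j / \<gamma>)))"

text \<open>Shifting \<open>l\<close> by one turns the atoms for \<open>j\<close> into those for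
  \<open>j - 1\<close>, so only the top atom is new. Its compensator \<open>- i t\<close> cancels
  the unit change of the drift; the top jump thus enters as a plain, uncompensated Poisson
  term.\<close>

lemma levy_exponent_step:
  assumes \<gamma>: "\<gamma> > 0"
  shows "levy_exponent j \<gamma> t = levy_exponent (j - 1) \<gamma> t
    + of_real (levy_mass j \<gamma> 0) * (iexp (t * levy_atom j \<gamma> 0) - 1)"
proof -
  have mass: "levy_mass j \<gamma> (Suc l) = levy_mass (j - 1) \<gamma> l"
   and atom: "levy_atom j \<gamma> (Suc l) = levy_atom (j - 1) \<gamma> l" for l
    by (simp_all add: levy_mass_def levy_atom_def powr_diff powr_minus field_simps)
  have "(\<Sum>l. levy_term j \<gamma> t l) = (\<Sum>l. levy_term j \<gamma> t (Suc l)) + levy_term j \<gamma> t 0"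
    using suminf_split_head[OF summable_norm_cancel[OF summable_norm_levy_term[OF \<gamma>]], of j t] by simp
  also have "(\<lambda>l. levy_term j \<gamma> t (Suc l)) = levy_term (j - 1) \<gamma> t"
    by (rule ext) (simp only: levy_term_def mass atom)
  finally have S: "(\<Sum>l. levy_term j \<gamma> t l) = (\<Sum>l. levy_term (j - 1) \<gamma> t l) + levy_term j \<gamma> t 0" .
  have "complex_of_real (levy_mass j \<gamma> 0) * complex_of_real (levy_atom j \<gamma> 0) = 1"
    using levy_mass_atom[OF \<gamma>, of j 0] by (metis of_real_1 of_real_mult)
  then have "complex_of_real (levy_mass j \<gamma> 0) * (\<i> * complex_of_real (t * levy_atom j \<gamma> 0)) = \<i> * of_real t"
    by (metis (no_types, lifting) mult.assoc mult.commute mult.right_neutral of_real_mult)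
  then have "levy_term j \<gamma> t 0 = of_real (levy_mass j \<gamma> 0) * (iexp (t * levy_atom j \<gamma> 0) - 1) - \<i> * of_real t"
    by (simp add: levy_term_def right_diff_distrib)
  then show ?thesis unfolding levy_exponent_def S by (simp add: algebra_simps)
qed

text \<open>With \<open>s = \<gamma> 2^(-j)\<close> and \<open>u = t 2^j / \<gamma>\<close>, summing
  over the ties gives \<open>(exp (s e^(iu)) - 1) / (e^s - 1)\<close>, and
  \<open>p_jg j \<gamma> = exp (- 2 s) (e^s - 1)\<close> cancels the denominator. By
  \<open>levy_exponent_step\<close> the exponential raises the level from \<open>j - 1\<close> to
  \<open>j\<close>, while the \<open>- 1\<close> leaves it at \<open>j - 1\<close>, whose killing
  rate is \<open>2 s\<close>.\<close>

lemma char_max_law: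
  assumes \<gamma>: "\<gamma> > 0"
  shows "of_real (p_jg j \<gamma>) * char (max_law j \<gamma>) t = jump_factor j \<gamma> t * (psi j \<gamma> t - psi (j - 1) \<gamma> t)"
proof -
  define s where "s = levy_mass j \<gamma> 0"
  define u where "u = t * levy_atom j \<gamma> 0"
  have s: "s > 0" using levy_mass_pos[OF \<gamma>] by (simp add: s_def)
  have s2: "s = \<gamma> * 2 powr (- real_of_int j)" and u2: "u = t * (2 powr real_of_int j / \<gamma>)"
    by (simp_all add: s_def u_def levy_mass_def levy_atom_def)
  define \<phi> where "\<phi> = exp (levy_exponent (j - 1) \<gamma> t)"
  have J: "jump_factor j \<gamma> t = iexp (- u)" by (simp add: jump_factor_def u2)
  have comp: "char (component_law j \<gamma> m) t = iexp (- u) * \<phi> * iexp (u * real m)" for m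
  proof -
    have "t * ((real m - 1) * 2 powr real_of_int j / \<gamma>) = - u + u * real m"
      by (simp add: u2 diff_divide_distrib algebra_simps)
    then have "iexp (t * ((real m - 1) * 2 powr real_of_int j / \<gamma>)) = iexp (- u) * iexp (u * real m)"
      by (simp only: of_real_add distrib_left exp_add)
    then show ?thesis unfolding component_law_def
      by (simp add: char_distr_affine[OF real_distribution_W_law[OF \<gamma>]] char_W_law[OF \<gamma>] \<phi>_def mult_ac)
  qed
  have "char (max_law j \<gamma>) t = (\<integral>m. iexp (- u) * \<phi> * iexp (u * real m) \<partial>measure_pmf (ties_pmf j \<gamma>))"
    unfolding max_law_def by (subst real_distribution_bind_pmf(3)) (auto intro: real_distribution_component_law[OF \<gamma>] simp: comp)
  also have "\<dots> = iexp (- u) * \<phi> * (\<integral>m. iexp (u * real m) \<partial>measure_pmf (ties_pmf j \<gamma>))" by simp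
  also have "(\<integral>m. iexp (u * real m) \<partial>measure_pmf (ties_pmf j \<gamma>))
      = (exp (of_real s * iexp u) - 1) / of_real (exp s - 1)"
  proof -
    have p: "pmf (ties_pmf j \<gamma>) m = (s ^ m / fact m - (if m = 0 then 1 else 0)) / (exp s - 1)" for m
      by (simp add: pmf_ties[OF \<gamma>] r_jg_eq_mass s_def)
    have "(\<lambda>m. (s ^ m / fact m - (if m = 0 then 1 else 0)) / (exp s - 1)) sums ((exp s - 1) / (exp s - 1))"
      by (intro sums_divide sums_diff poisson_series sums_single)
    then have "summable (\<lambda>m. pmf (ties_pmf j \<gamma>) m * norm (iexp (u * real m)))"
      unfolding p by (simp add: sums_iff)
    from integral_measure_pmf_nat_sums(2)[OF this]
    have 1: "(\<lambda>m. pmf (ties_pmf j \<gamma>) m *\<^sub>R iexp (u * real m)) sums (\<integral>m. iexp (u * real m) \<partial>measure_pmf (ties_pmf j \<gamma>))" .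
    have "(\<lambda>m. ((of_real s * iexp u) ^ m /\<^sub>R fact m - (if m = 0 then 1 else 0)) / of_real (exp s - 1))
        sums ((exp (of_real s * iexp u) - 1) / of_real (exp s - 1))"
      by (intro sums_divide sums_diff exp_converges sums_single)
    also have "(\<lambda>m. ((of_real s * iexp u) ^ m /\<^sub>R fact m - (if m = 0 then 1 else 0)) / of_real (exp s - 1))
        = (\<lambda>m. pmf (ties_pmf j \<gamma>) m *\<^sub>R iexp (u * real m))"
      unfolding p by (rule ext)
        (simp add: scaleR_conv_of_real power_mult_distrib exp_of_nat_mult[symmetric] field_simps)
    finally show ?thesis using 1 by (rule sums_unique2[rotated])
  qed
  finally have char: "char (max_law j \<gamma>) t = iexp (- u) * \<phi> * ((exp (of_real s * iexp u) - 1) / of_real (exp s - 1))" .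
  have p: "p_jg j \<gamma> = exp (- 2 * s) * (exp s - 1)"
  proof -
    have "p_jg j \<gamma> = exp (- s) * (1 - exp (- s))" by (simp add: p_jg_def s2)
    moreover have "exp (- s) * exp s = 1" by (simp add: exp_minus)
    moreover have "exp (- 2 * s) = exp (- s) * exp (- s)" by (simp add: exp_add[symmetric])
    ultimately show ?thesis by (simp add: algebra_simps)
  qed
  have "of_real (p_jg j \<gamma>) * char (max_law j \<gamma>) t
      = iexp (- u) * (\<phi> * of_real (exp (- 2 * s)) * (exp (of_real s * iexp u) - 1))"
    using s unfolding char p by simp
  also have "\<phi> * of_real (exp (- 2 * s)) * (exp (of_real s * iexp u) - 1) = psi j \<gamma> t - psi (j - 1) \<gamma> t"
  proof -
    have "2 powr (- real_of_int (j - 1)) = 2 * 2 powr (- real_of_int j)"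
      by (simp add: powr_diff powr_minus field_simps)
    then have s': "\<gamma> * 2 powr (- real_of_int (j - 1)) = 2 * s" by (simp add: s2)
    have "psi (j - 1) \<gamma> t = \<phi> * of_real (exp (- 2 * s))"
    proof -
      have "psi (j - 1) \<gamma> t = exp (levy_exponent (j - 1) \<gamma> t + of_real (- 2 * s))"
        unfolding psi_def s' by simp
      then show ?thesis by (simp only: exp_add \<phi>_def exp_of_real)
    qed
    moreover have "psi j \<gamma> t = \<phi> * of_real (exp (- 2 * s)) * exp (of_real s * iexp u)"
    proof -
      have "psi j \<gamma> t = exp (levy_exponent (j - 1) \<gamma> t + of_real (- 2 * s) + of_real s * iexp u)"
        unfolding psi_def levy_exponent_step[OF \<gamma>, of j t] s2[symmetric] s_def[symmetric] u_def[symmetric]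
        by (simp add: algebra_simps)
      then show ?thesis by (simp only: exp_add \<phi>_def exp_of_real)
    qed
    ultimately show ?thesis by (simp add: algebra_simps)
  qed
  finally show ?thesis by (simp add: J)
qed

text \<open>The error is the weight outside the window: at most \<open>\<gamma> / 2^J\<close> above
  it and \<open>exp (- 2 \<gamma> 2^J)\<close> below; \<open>1/2 \<le> \<gamma> \<le> 1\<close>
  makes both uniform.\<close>

lemma char_Gstar_law_truncate:
  assumes \<gamma>: "1 / 2 \<le> \<gamma>" "\<gamma> \<le> 1"
  shows "norm (char (Gstar_law \<gamma>) t
    - (\<Sum>j\<in>{- int J..int J}. jump_factor j \<gamma> t * (psi j \<gamma> t - psi (j - 1) \<gamma> t))) \<le> 1 / 2 ^ J + exp (- (2 ^ J))"
proof -
  have \<gamma>0: "\<gamma> > 0" using \<gamma> by simp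
  have "char (Gstar_law \<gamma>) t = (\<integral>j. char (max_law j \<gamma>) t \<partial>measure_pmf (max_index_pmf \<gamma>))"
    unfolding Gstar_law_def by (subst real_distribution_bind_pmf(3)) (auto intro: real_distribution_max_law[OF \<gamma>0])
  then have "norm (char (Gstar_law \<gamma>) t - (\<Sum>j\<in>{- int J..int J}. of_real (p_jg j \<gamma>) * char (max_law j \<gamma>) t))
      \<le> 1 - (\<Sum>j\<in>{- int J..int J}. p_jg j \<gamma>)"
    using norm_expectation_pmf_truncate[of "\<lambda>j. char (max_law j \<gamma>) t" "{- int J..int J}" "max_index_pmf \<gamma>"]
      real_distribution.cmod_char_le_1[OF real_distribution_max_law[OF \<gamma>0]]
    by (simp add: pmf_max_index[OF \<gamma>0])
  also have "\<dots> = (1 - exp (- \<gamma> / 2 ^ J)) + exp (- \<gamma> * 2 ^ Suc J)" by (simp only: sum_p_jg)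
  also have "\<dots> \<le> 1 / 2 ^ J + exp (- (2 ^ J))"
  proof (rule add_mono)
    have "1 - exp (- \<gamma> / 2 ^ J) \<le> \<gamma> / 2 ^ J" using exp_ge_add_one_self[of "- \<gamma> / 2 ^ J"] by simp
    also have "\<dots> \<le> 1 / 2 ^ J" using \<gamma> by (simp add: divide_right_mono)
    finally show "1 - exp (- \<gamma> / 2 ^ J) \<le> 1 / 2 ^ J" .
    have "(2::real) ^ J * 1 \<le> 2 ^ J * (2 * \<gamma>)" using \<gamma> by (intro mult_left_mono) auto
    then show "exp (- \<gamma> * 2 ^ Suc J) \<le> exp (- (2 ^ J))" by (simp add: mult_ac)
  qed
  finally show ?thesis by (simp only: char_max_law[OF \<gamma>0])
qed

section \<open>The trimmed sum\<close>

text \<open>The \<open>a_K\<close> of the overview, at \<open>s = t / n\<close>. As a defective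
  characteristic function it takes the value \<open>1 - 2^(-K)\<close> at 0.\<close>

definition trunc_char :: "nat \<Rightarrow> real \<Rightarrow> complex" where
  "trunc_char K s = (\<Sum>k\<in>{1..K}. of_real (1 / 2 ^ k) * iexp (s * 2 ^ k))"

lemma sum_half_powers: "(\<Sum>k\<in>{1..K}. 1 / 2 ^ k :: real) = 1 - 1 / 2 ^ K"
  by (induction K) (auto simp: field_simps)

lemma trunc_char_0: "trunc_char K 0 = of_real (1 - 1 / 2 ^ K)"
proof -
  have "trunc_char K 0 = of_real (\<Sum>k\<in>{1..K}. 1 / 2 ^ k)" by (simp add: trunc_char_def)
  then show ?thesis by (simp only: sum_half_powers)
qed

lemma norm_trunc_char_le_1: "norm (trunc_char K s) \<le> 1"
proof -
  have "norm (trunc_char K s) \<le> (\<Sum>k\<in>{1..K}. norm (of_real (1 / 2 ^ k) * iexp (s * 2 ^ k)))"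
    unfolding trunc_char_def by (rule norm_sum)
  also have "\<dots> = (\<Sum>k\<in>{1..K}. 1 / 2 ^ k :: real)"
    by (intro sum.cong) (auto simp: norm_mult norm_divide norm_power)
  finally show ?thesis unfolding sum_half_powers by (simp add: order_trans)
qed

section \<open>Exact expectations for the Petersburg sequence\<close>

locale petersburg_sequence = prob_space M for M :: "'a measure" +
  fixes X :: "nat \<Rightarrow> 'a \<Rightarrow> real"
  assumes indep: "indep_vars (\<lambda>_. borel) X {1..}"
    and dist: "\<And>i k. i \<ge> 1 \<Longrightarrow> k \<ge> 1 \<Longrightarrow> measure M {\<omega> \<in> space M. X i \<omega> = 2 ^ k} = 1 / 2 ^ k"
begin

lemma measurable_X: "i \<ge> 1 \<Longrightarrow> X i \<in> borel_measurable M"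
  using indep by (auto simp: indep_vars_def)

text \<open>The prescribed point probabilities already sum to 1, which leaves no mass
  elsewhere.\<close>

lemma AE_X_power_of_2:
  assumes i: "i \<ge> 1"
  shows "AE \<omega> in M. \<exists>k\<ge>1. X i \<omega> = 2 ^ k"
proof -
  have [measurable]: "X i \<in> borel_measurable M" by (rule measurable_X[OF i])
  define A where "A k = {\<omega> \<in> space M. X i \<omega> = 2 ^ Suc k}" for k
  have A: "A k \<in> sets M" for k unfolding A_def by measurable
  have "disjoint_family A" by (auto simp: disjoint_family_on_def A_def)
  then have "(\<lambda>k. prob (A k)) sums prob (\<Union>k. A k)"
    using A by (intro finite_measure_UNION) auto
  moreover have "prob (A k) = (1 / 2) ^ Suc k" for k
    unfolding A_def using dist[OF i, of "Suc k"] by (simp add: power_divide)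
  ultimately have "prob (\<Union>k. A k) = 1"
    using power_half_series sums_unique2 by simp
  then have "AE \<omega> in M. \<omega> \<in> (\<Union>k. A k)"
    using A by (subst (asm) prob_eq_1) auto
  then show ?thesis
  proof eventually_elim
    case (elim \<omega>)
    then obtain k where "\<omega> \<in> A k" by blast
    then show ?case by (intro exI[of _ "Suc k"]) (simp add: A_def)
  qed
qed

lemma expectation_truncated:
  assumes i: "i \<ge> 1"
  shows "(\<integral>\<omega>. indicator {..2 ^ K} (X i \<omega>) *\<^sub>R iexp (s * X i \<omega>) \<partial>M) = trunc_char K s"
proof -
  have [measurable]: "X i \<in> borel_measurable M" by (rule measurable_X[OF i])
  let ?A = "\<lambda>k. {\<omega> \<in> space M. X i \<omega> = 2 ^ k}"
  have "(\<integral>\<omega>. indicator {..2 ^ K} (X i \<omega>) *\<^sub>R iexp (s * X i \<omega>) \<partial>M)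
      = (\<integral>\<omega>. (\<Sum>k\<in>{1..K}. indicator (?A k) \<omega> *\<^sub>R iexp (s * 2 ^ k)) \<partial>M)"
  proof (rule integral_cong_AE)
    show "AE \<omega> in M. indicator {..2 ^ K} (X i \<omega>) *\<^sub>R iexp (s * X i \<omega>)
        = (\<Sum>k\<in>{1..K}. indicator (?A k) \<omega> *\<^sub>R iexp (s * 2 ^ k))"
      using AE_X_power_of_2[OF i] AE_space
    proof eventually_elim
      case (elim \<omega>)
      then obtain m where m: "m \<ge> 1" "X i \<omega> = 2 ^ m" by blast
      have "(\<Sum>k\<in>{1..K}. indicator (?A k) \<omega> *\<^sub>R iexp (s * 2 ^ k))
          = (\<Sum>k\<in>{1..K}. if k = m then iexp (s * 2 ^ m) else 0)"
        using elim m by (intro sum.cong) (auto simp: indicator_def)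
      also have "\<dots> = (if m \<le> K then iexp (s * 2 ^ m) else 0)" using m by simp
      finally show ?case using m by (simp add: indicator_def)
    qed
    show "(\<lambda>\<omega>. indicator {..2 ^ K} (X i \<omega>) *\<^sub>R iexp (s * X i \<omega>)) \<in> borel_measurable M"
      "(\<lambda>\<omega>. \<Sum>k\<in>{1..K}. indicator (?A k) \<omega> *\<^sub>R iexp (s * 2 ^ k)) \<in> borel_measurable M"
      by measurable
  qed
  also have "\<dots> = (\<Sum>k\<in>{1..K}. prob (?A k) *\<^sub>R iexp (s * 2 ^ k))"
  proof -
    have "integrable M (\<lambda>\<omega>. indicator (?A k) \<omega> :: real)" for k
      by (rule integrable_const_bound[where B=1]) auto
    then show ?thesis
      by (subst Bochner_Integration.integral_sum)
         (auto intro!: integrable_scaleR_left sum.cong simp: integral_scaleR_left simp del: of_real_mult of_real_power)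
  qed
  also have "\<dots> = trunc_char K s"
    unfolding trunc_char_def using dist[OF i] by (intro sum.cong) (auto simp: scaleR_conv_of_real)
  finally show ?thesis .
qed

definition total :: "nat \<Rightarrow> 'a \<Rightarrow> real" where
  "total n \<omega> = (\<Sum>i\<in>{1..n}. X i \<omega>)"

definition largest :: "nat \<Rightarrow> 'a \<Rightarrow> real" where
  "largest n \<omega> = Max ((\<lambda>i. X i \<omega>) ` {1..n})"

lemma measurable_total [measurable]: "total n \<in> borel_measurable M"
  unfolding total_def[abs_def] using measurable_X by (intro borel_measurable_sum) auto

lemma measurable_largest [measurable]: "largest n \<in> borel_measurable M"
  unfolding largest_def[abs_def] using measurable_X by (intro borel_measurable_Max) auto

text \<open>Bounding the maximum bounds each observation separately, so the integrand is a product
  and independence applies. An event with equality would not factor; hence the detour over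
  differences.\<close>

lemma expectation_total_truncated:
  assumes n: "n \<ge> 1"
  shows "(\<integral>\<omega>. indicator {..2 ^ K} (largest n \<omega>) *\<^sub>R iexp (s * total n \<omega>) \<partial>M) = trunc_char K s ^ n"
proof -
  let ?g = "\<lambda>x::real. indicator {..2 ^ K} x *\<^sub>R iexp (s * x)"
  have pw: "indicator {..2 ^ K} (largest n \<omega>) *\<^sub>R iexp (s * total n \<omega>) = (\<Prod>i\<in>{1..n}. ?g (X i \<omega>))" for \<omega>
  proof (cases "largest n \<omega> \<le> 2 ^ K")
    case True
    then have "X i \<omega> \<le> 2 ^ K" if "i \<in> {1..n}" for i
      using that n unfolding largest_def by (subst (asm) Max_le_iff) auto
    then have "(\<Prod>i\<in>{1..n}. ?g (X i \<omega>)) = (\<Prod>i\<in>{1..n}. iexp (s * X i \<omega>))"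
      by (intro prod.cong) auto
    also have "\<dots> = iexp (s * total n \<omega>)"
      by (simp add: exp_sum[symmetric] total_def sum_distrib_left)
    finally show ?thesis using True by simp
  next
    case False
    then obtain i where "i \<in> {1..n}" "\<not> X i \<omega> \<le> 2 ^ K"
      using n unfolding largest_def by (subst (asm) Max_le_iff) auto
    then have "(\<Prod>i\<in>{1..n}. ?g (X i \<omega>)) = 0" by (intro prod_zero bexI[of _ i]) auto
    then show ?thesis using False by simp
  qed
  have ind: "indep_vars (\<lambda>_. borel) (\<lambda>i \<omega>. ?g (X i \<omega>)) {1..n}"
    by (rule indep_vars_compose2[OF indep_vars_subset[OF indep]]) auto
  have "(\<integral>\<omega>. (\<Prod>i\<in>{1..n}. ?g (X i \<omega>)) \<partial>M) = (\<Prod>i\<in>{1..n}. \<integral>\<omega>. ?g (X i \<omega>) \<partial>M)"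
  proof (rule indep_vars_lebesgue_integral[OF _ ind])
    fix i assume "i \<in> {1..n}"
    then have [measurable]: "X i \<in> borel_measurable M" by (intro measurable_X) auto
    show "integrable M (\<lambda>\<omega>. ?g (X i \<omega>))"
      by (rule integrable_const_bound[where B=1]) (auto simp: indicator_def)
  qed simp
  also have "\<dots> = (\<Prod>i\<in>{1..n}. trunc_char K s)"
    by (intro prod.cong expectation_truncated) auto
  finally show ?thesis unfolding pw by simp
qed

text \<open>The case \<open>s = 0\<close> of \<open>expectation_total_truncated\<close>, where the
  exponential disappears.\<close>

lemma prob_largest_le:
  assumes n: "n \<ge> 1"
  shows "prob {\<omega> \<in> space M. largest n \<omega> \<le> 2 ^ K} = (1 - 1 / 2 ^ K) ^ n"
proof -
  let ?A = "{\<omega> \<in> space M. largest n \<omega> \<le> 2 ^ K}"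
  have "complex_of_real (prob ?A) = (\<integral>\<omega>. of_real (indicator ?A \<omega>) \<partial>M)"
    by (subst integral_complex_of_real) simp
  also have "\<dots> = (\<integral>\<omega>. indicator {..2 ^ K} (largest n \<omega>) *\<^sub>R iexp (0 * total n \<omega>) \<partial>M)"
    by (intro Bochner_Integration.integral_cong) (auto simp: indicator_def)
  also have "\<dots> = of_real ((1 - 1 / 2 ^ K) ^ n)"
    using expectation_total_truncated[OF n, of K 0] by (simp only: trunc_char_0 of_real_power)
  finally show ?thesis by (simp only: of_real_eq_iff)
qed

lemma AE_largest_power_of_2:
  assumes n: "n \<ge> 1"
  shows "AE \<omega> in M. \<exists>k\<ge>1. largest n \<omega> = 2 ^ k"
proof -
  have "AE \<omega> in M. \<forall>i\<in>{1..n}. \<exists>k\<ge>1. X i \<omega> = 2 ^ k"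
    using AE_X_power_of_2 by (intro AE_finite_allI) auto
  then show ?thesis
  proof eventually_elim
    case (elim \<omega>)
    have "largest n \<omega> \<in> (\<lambda>i. X i \<omega>) ` {1..n}"
      unfolding largest_def using n by (intro Max_in) auto
    then show ?case using elim by auto
  qed
qed

text \<open>Maxima outside the window are the only error: those above \<open>2^K2\<close> are
  controlled by Bernoulli's inequality, those up to \<open>2^K1\<close> by
  \<open>1 - x \<le> exp (- x)\<close>.\<close>

lemma expectation_trimmed_truncate:
  assumes n: "n \<ge> 1" and K: "K1 \<le> K2"
  shows "norm ((\<integral>\<omega>. iexp (s * (total n \<omega> - largest n \<omega>)) \<partial>M)
      - (\<Sum>K\<in>{Suc K1..K2}. iexp (- (s * 2 ^ K)) * (trunc_char K s ^ n - trunc_char (K - 1) s ^ n)))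
    \<le> real n / 2 ^ K2 + exp (- (real n / 2 ^ K1))"
proof -
  let ?T = "\<lambda>K \<omega>. indicator {..2 ^ K} (largest n \<omega>) *\<^sub>R iexp (s * total n \<omega>)"
  let ?Z = "\<lambda>\<omega>. iexp (s * (total n \<omega> - largest n \<omega>))"
  let ?B = "{\<omega> \<in> space M. 2 ^ K1 < largest n \<omega> \<and> largest n \<omega> \<le> 2 ^ K2}"
  have iT: "integrable M (?T K)" for K
    by (rule integrable_const_bound[where B=1]) (auto simp: indicator_def)
  have iZ: "integrable M ?Z" by (rule integrable_const_bound[where B=1]) auto
  have B[measurable]: "?B \<in> sets M" by measurable
  have iZB: "integrable M (\<lambda>\<omega>. indicator ?B \<omega> *\<^sub>R ?Z \<omega>)"
    by (rule integrable_const_bound[where B=1]) (auto simp: indicator_def)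
  have "(\<integral>\<omega>. indicator ?B \<omega> *\<^sub>R ?Z \<omega> \<partial>M)
      = (\<integral>\<omega>. (\<Sum>K\<in>{Suc K1..K2}. iexp (- (s * 2 ^ K)) * (?T K \<omega> - ?T (K - 1) \<omega>)) \<partial>M)"
  proof (rule integral_cong_AE)
    show "AE \<omega> in M. indicator ?B \<omega> *\<^sub>R ?Z \<omega>
        = (\<Sum>K\<in>{Suc K1..K2}. iexp (- (s * 2 ^ K)) * (?T K \<omega> - ?T (K - 1) \<omega>))"
      using AE_largest_power_of_2[OF n] AE_space
    proof eventually_elim
      case (elim \<omega>)
      then obtain m where m: "m \<ge> 1" "largest n \<omega> = 2 ^ m" by blast
      \<comment> \<open>Only \<open>K = m\<close> survives: for other \<open>K\<close> the
        conditions \<open>m \<le> K\<close> and \<open>m \<le> K - 1\<close> agree, since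
        \<open>K \<ge> 1\<close> in the window.\<close>
      have "iexp (- (s * 2 ^ K)) * (?T K \<omega> - ?T (K - 1) \<omega>)
          = (if K = m then iexp (- (s * 2 ^ m)) * iexp (s * total n \<omega>) else 0)"
        if "K \<in> {Suc K1..K2}" for K
      proof (cases "K = m")
        case True
        then have "\<not> (2::real) ^ m \<le> 2 ^ (K - 1)" using m by (subst power_increasing_iff) auto
        then show ?thesis using True m by simp
      next
        case False
        have "(2::real) ^ m \<le> 2 ^ K \<longleftrightarrow> (2::real) ^ m \<le> 2 ^ (K - 1)"
          using False that m by (subst (1 2) power_increasing_iff) auto
        then show ?thesis using False m by (simp add: indicator_def)
      qed
      then have "(\<Sum>K\<in>{Suc K1..K2}. iexp (- (s * 2 ^ K)) * (?T K \<omega> - ?T (K - 1) \<omega>))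
          = (\<Sum>K\<in>{Suc K1..K2}. if K = m then iexp (- (s * 2 ^ m)) * iexp (s * total n \<omega>) else 0)"
        by (intro sum.cong) auto
      also have "\<dots> = (if Suc K1 \<le> m \<and> m \<le> K2 then iexp (- (s * 2 ^ m)) * iexp (s * total n \<omega>) else 0)"
        by simp
      also have "iexp (- (s * 2 ^ m)) * iexp (s * total n \<omega>) = ?Z \<omega>"
      proof -
        have "s * (total n \<omega> - largest n \<omega>) = - (s * 2 ^ m) + s * total n \<omega>"
          by (simp add: m algebra_simps)
        then show ?thesis by (simp only: of_real_add distrib_left exp_add)
      qed
      finally show ?case using m elim by (auto simp: indicator_def)
    qed
  qed auto
  also have "\<dots> = (\<Sum>K\<in>{Suc K1..K2}. \<integral>\<omega>. iexp (- (s * 2 ^ K)) * (?T K \<omega> - ?T (K - 1) \<omega>) \<partial>M)"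
    using iT by (intro Bochner_Integration.integral_sum integrable_mult_right Bochner_Integration.integrable_diff) auto
  also have "\<dots> = (\<Sum>K\<in>{Suc K1..K2}. iexp (- (s * 2 ^ K)) * (trunc_char K s ^ n - trunc_char (K - 1) s ^ n))"
    using iT expectation_total_truncated[OF n] by (intro sum.cong) auto
  finally have eq: "(\<integral>\<omega>. indicator ?B \<omega> *\<^sub>R ?Z \<omega> \<partial>M)
    = (\<Sum>K\<in>{Suc K1..K2}. iexp (- (s * 2 ^ K)) * (trunc_char K s ^ n - trunc_char (K - 1) s ^ n))" .
  have "norm ((\<integral>\<omega>. ?Z \<omega> \<partial>M) - (\<integral>\<omega>. indicator ?B \<omega> *\<^sub>R ?Z \<omega> \<partial>M))
      \<le> (\<integral>\<omega>. norm (?Z \<omega> - indicator ?B \<omega> *\<^sub>R ?Z \<omega>) \<partial>M)"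
    unfolding Bochner_Integration.integral_diff[OF iZ iZB, symmetric] by (rule integral_norm_bound)
  also have "\<dots> = (\<integral>\<omega>. indicator (space M - ?B) \<omega> \<partial>M)"
  proof (rule Bochner_Integration.integral_cong[OF refl])
    fix \<omega> assume \<omega>: "\<omega> \<in> space M"
    have "norm (z - c *\<^sub>R z) = \<bar>1 - c\<bar> * norm z" for z :: complex and c :: real
      by (metis norm_scaleR scaleR_left_diff_distrib scaleR_one)
    then have "norm (?Z \<omega> - indicator ?B \<omega> *\<^sub>R ?Z \<omega>) = \<bar>1 - indicator ?B \<omega>\<bar>"
      by (simp only: norm_exp_i_times mult_1_right)
    then show "norm (?Z \<omega> - indicator ?B \<omega> *\<^sub>R ?Z \<omega>) = indicator (space M - ?B) \<omega>"
      using \<omega> by (simp only:) (simp add: indicator_def)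
  qed
  also have "\<dots> = prob (space M - ?B)" by simp
  also have "\<dots> = 1 - prob ?B" by (rule prob_compl[OF B])
  also have "1 - prob ?B = (1 - (1 - 1 / 2 ^ K2) ^ n) + (1 - 1 / 2 ^ K1) ^ n"
  proof -
    have le: "(2::real) ^ K1 \<le> 2 ^ K2" using K by (intro power_increasing) auto
    have "?B = {\<omega> \<in> space M. largest n \<omega> \<le> 2 ^ K2} - {\<omega> \<in> space M. largest n \<omega> \<le> 2 ^ K1}" by auto
    moreover have "prob ({\<omega> \<in> space M. largest n \<omega> \<le> 2 ^ K2} - {\<omega> \<in> space M. largest n \<omega> \<le> 2 ^ K1})
        = prob {\<omega> \<in> space M. largest n \<omega> \<le> 2 ^ K2} - prob {\<omega> \<in> space M. largest n \<omega> \<le> 2 ^ K1}"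
      by (intro finite_measure_Diff) (auto intro: order_trans[OF _ le])
    ultimately have "prob ?B = (1 - 1 / 2 ^ K2) ^ n - (1 - 1 / 2 ^ K1) ^ n"
      by (simp only: prob_largest_le[OF n])
    then show ?thesis by (simp only:)
  qed

  also have "\<dots> \<le> real n / 2 ^ K2 + exp (- (real n / 2 ^ K1))"
  proof (rule add_mono)
    have "1 + real n * (- (1 / 2 ^ K2)) \<le> (1 + (- (1 / 2 ^ K2))) ^ n"
      by (rule Bernoulli_inequality) simp
    then show "1 - (1 - 1 / 2 ^ K2) ^ n \<le> real n / 2 ^ K2" by simp
    have "(1 - 1 / 2 ^ K1) ^ n \<le> exp (- (1 / 2 ^ K1 :: real)) ^ n"
      using exp_ge_add_one_self[of "- (1 / 2 ^ K1)"] by (intro power_mono) auto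
    also have "\<dots> = exp (- (real n / 2 ^ K1))" by (simp add: exp_of_nat_mult[symmetric])
    finally show "(1 - 1 / 2 ^ K1) ^ n \<le> exp (- (real n / 2 ^ K1))" .
  qed
  finally show ?thesis unfolding eq .
qed

end

section \<open>Convergence of the truncated characteristic functions\<close>

text \<open>For \<open>n \<ge> 1\<close> the ceiling is nonnegative, so \<open>nat\<close> loses
  nothing.\<close>

definition scale_exp :: "nat \<Rightarrow> nat" where
  "scale_exp n = nat \<lceil>log 2 (real n)\<rceil>"

definition scale_frac :: "nat \<Rightarrow> real" where
  "scale_frac n = real n / 2 powr (real_of_int \<lceil>log 2 (real n)\<rceil>)"

lemma scale:
  assumes n: "n \<ge> 1"
  shows scale_eq: "real n = scale_frac n * 2 ^ scale_exp n"
    and scale_frac_ge: "1 / 2 \<le> scale_frac n" and scale_frac_le: "scale_frac n \<le> 1"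
    and log_scale: "log 2 (real n) = real (scale_exp n) + log 2 (scale_frac n)"
    and scale_exp_le: "real (scale_exp n) \<le> log 2 (real n) + 1"
    and scale_exp_ge: "log 2 (real n) \<le> real (scale_exp n)"
proof -
  let ?x = "log 2 (real n)"
  have x: "0 \<le> ?x" using n by simp
  have N: "real_of_int \<lceil>?x\<rceil> = real (scale_exp n)" using x by (simp add: scale_exp_def)
  have f: "scale_frac n = real n / 2 ^ scale_exp n"
    unfolding scale_frac_def N by (simp add: powr_realpow)
  show 1: "real n = scale_frac n * 2 ^ scale_exp n" by (simp add: f)
  show le: "real (scale_exp n) \<le> ?x + 1" and ge: "?x \<le> real (scale_exp n)"
    using N by linarith+
  have e: "real n = 2 powr ?x" using n by simp
  have "2 powr ?x \<le> 2 powr real (scale_exp n)" using ge by simp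
  then have "real n \<le> 2 ^ scale_exp n" using n by (simp add: powr_realpow)
  then show "scale_frac n \<le> 1" by (simp add: f)
  have "2 powr real (scale_exp n) \<le> 2 powr (?x + 1)" using le by (intro powr_mono) auto
  then have "2 ^ scale_exp n \<le> 2 * real n" using n by (simp add: powr_realpow powr_add)
  then show ge2: "1 / 2 \<le> scale_frac n" by (simp add: f field_simps)
  have "log 2 (real n) = log 2 (scale_frac n * 2 ^ scale_exp n)" using 1 by simp
  also have "\<dots> = log 2 (scale_frac n) + real (scale_exp n)"
    using ge2 by (subst log_mult) (auto simp: log_nat_power)
  finally show "?x = real (scale_exp n) + log 2 (scale_frac n)" by simp
qed

lemma filterlim_scale_exp: "filterlim scale_exp at_top sequentially"
proof (subst filterlim_at_top, intro allI)
  fix Z :: nat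
  have "filterlim (\<lambda>n. log 2 (real n)) at_top sequentially" by real_asymp
  then have "\<forall>\<^sub>F n in sequentially. real Z \<le> log 2 (real n)" by (simp add: filterlim_at_top)
  moreover have "\<forall>\<^sub>F n in sequentially. n \<ge> (1::nat)" by (rule eventually_ge_at_top)
  ultimately show "\<forall>\<^sub>F n in sequentially. Z \<le> scale_exp n"
  proof eventually_elim
    case (elim n)
    then show ?case using scale_exp_ge[of n] by linarith
  qed
qed

text \<open>Only meaningful for \<open>- scale_exp n \<le> j\<close>: \<open>nat\<close> truncates.\<close>

definition level :: "nat \<Rightarrow> int \<Rightarrow> nat" where
  "level n j = nat (int (scale_exp n) + j)"

lemma norm_exp_minus_1_minus:
  fixes z :: complex
  assumes "norm z \<le> 2"
  shows "norm (exp z - 1 - z) \<le> exp 2 * (norm z)\<^sup>2"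
proof -
  have "norm (exp z - (\<Sum>k\<le>1. z ^ k / fact k)) \<le> exp \<bar>Re z\<bar> * norm z ^ Suc 1 / fact 1"
    by (rule Taylor_exp)
  also have "\<dots> \<le> exp 2 * (norm z)\<^sup>2"
    using abs_Re_le_cmod[of z] assms by (auto intro!: mult_right_mono simp: power2_eq_square)
  finally show ?thesis by (simp add: algebra_simps)
qed

text \<open>Both \<open>a\<close> and \<open>exp (a - 1)\<close> lie in the unit disc, so their
  powers differ by at most \<open>n\<close> times the difference of the bases, which is of second
  order. The constant \<open>exp 2\<close> reflects \<open>norm (a - 1) \<le> 2\<close>.\<close>

lemma norm_power_minus_exp:
  fixes a :: complex
  assumes a: "norm a \<le> 1"
  shows "norm (a ^ n - exp (of_nat n * (a - 1))) \<le> real n * (exp 2 * (norm (a - 1))\<^sup>2)"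
proof -
  have "Re a \<le> 1" using complex_Re_le_cmod[of a] a by linarith
  then have e: "norm (exp (a - 1)) \<le> 1" by simp
  have "norm (a - 1) \<le> 2" using norm_triangle_ineq4[of a 1] a by simp
  from norm_exp_minus_1_minus[OF this] have "norm (a - exp (a - 1)) \<le> exp 2 * (norm (a - 1))\<^sup>2"
    by (simp add: norm_minus_commute algebra_simps)
  then have "real n * norm (a - exp (a - 1)) \<le> real n * (exp 2 * (norm (a - 1))\<^sup>2)"
    by (intro mult_left_mono) auto
  moreover have "norm (a ^ n - exp (a - 1) ^ n) \<le> real n * norm (a - exp (a - 1))"
    by (rule norm_power_diff[OF a e])
  ultimately show ?thesis by (simp add: exp_of_nat_mult)
qed

text \<open>Splits 1 into the probabilities up to level \<open>K\<close> and the missing mass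
  \<open>1 / 2^K\<close>, so that each remaining term has the shape of an uncompensated
  jump.\<close>

lemma trunc_char_minus_1:
  "trunc_char K s - 1 = (\<Sum>k\<in>{1..K}. of_real (1 / 2 ^ k) * (iexp (s * 2 ^ k) - 1)) - of_real (1 / 2 ^ K)"
proof -
  have "(\<Sum>k\<in>{1..K}. complex_of_real (1 / 2 ^ k) * (iexp (s * 2 ^ k) - 1))
      = trunc_char K s - of_real (\<Sum>k\<in>{1..K}. 1 / 2 ^ k)"
    unfolding trunc_char_def of_real_sum sum_subtractf[symmetric]
    by (intro sum.cong) (auto simp: algebra_simps)
  then show ?thesis by (simp only: sum_half_powers) simp
qed

text \<open>The factor \<open>2^k\<close> cancels, so each of the \<open>K\<close> terms is at most
  \<open>\<bar>s\<bar>\<close>. With \<open>K\<close> of order \<open>log n\<close> and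
  \<open>s = t / n\<close>, \<open>n\<close> times the square still tends to 0.\<close>

lemma norm_trunc_char_minus_1: "norm (trunc_char K s - 1) \<le> 1 / 2 ^ K + real K * \<bar>s\<bar>"
proof -
  have "norm (\<Sum>k\<in>{1..K}. complex_of_real (1 / 2 ^ k) * (iexp (s * 2 ^ k) - 1)) \<le> (\<Sum>k\<in>{1..K}. \<bar>s\<bar>)"
  proof (rule sum_norm_le)
    fix k
    have "norm (complex_of_real (1 / 2 ^ k) * (iexp (s * 2 ^ k) - 1)) = 1 / 2 ^ k * norm (iexp (s * 2 ^ k) - 1)"
      by (simp add: norm_mult norm_divide norm_power)
    also have "\<dots> \<le> 1 / 2 ^ k * \<bar>s * 2 ^ k\<bar>"
      by (intro mult_left_mono norm_iexp_minus_1) auto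
    also have "\<dots> = \<bar>s\<bar>" by (simp add: abs_mult)
    finally show "norm (complex_of_real (1 / 2 ^ k) * (iexp (s * 2 ^ k) - 1)) \<le> \<bar>s\<bar>" .
  qed
  moreover have "norm (complex_of_real (1 / 2 ^ K)) = 1 / 2 ^ K" by (simp add: norm_divide norm_power)
  ultimately show ?thesis unfolding trunc_char_minus_1
    using norm_triangle_ineq4[of "\<Sum>k\<in>{1..K}. complex_of_real (1 / 2 ^ k) * (iexp (s * 2 ^ k) - 1)" "complex_of_real (1 / 2 ^ K)"]
    by simp
qed

text \<open>With \<open>k = K - l\<close>, \<open>n / 2^k\<close> is a mass and
  \<open>2^k / n\<close> an atom, so the identity is exact. The \<open>K\<close> missing
  compensators add up to \<open>i t K\<close>, which the centering turns into the drift; the missing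
  mass gives \<open>n / 2^K = \<gamma> 2^(-j)\<close>. Atoms with \<open>l \<ge> K\<close> match no
  value of the observations; they start at \<open>1 / n\<close> and form the remainder.\<close>

lemma levy_exponent_partial:
  assumes n: "n \<ge> 1" and K: "int (scale_exp n) + j \<ge> 0"
  defines "\<gamma> \<equiv> scale_frac n"
  shows "of_nat n * (trunc_char (level n j) (t / real n) - 1) - \<i> * of_real (t * log 2 (real n))
    = levy_exponent j \<gamma> t - of_real (\<gamma> * 2 powr (- real_of_int j)) - (\<Sum>l. levy_term j \<gamma> t (l + level n j))"
    and "norm (\<Sum>l. levy_term j \<gamma> t (l + level n j)) \<le> t\<^sup>2 / real n"
proof -
  define K where "K = level n j"
  define N where "N = scale_exp n"
  have iK: "int K = int N + j" using K by (simp add: K_def N_def level_def)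
  then have rK: "real K = real N + real_of_int j" by (metis of_int_add of_int_of_nat_eq)
  have \<gamma>: "\<gamma> > 0" using scale_frac_ge[OF n] by (simp add: \<gamma>_def)
  have ng: "real n = \<gamma> * 2 ^ N" using scale_eq[OF n] by (simp add: \<gamma>_def N_def)
  have n0: "real n > 0" using n by simp
  have pK: "2 powr real_of_int j = 2 ^ K / 2 ^ N"
    using rK by (simp add: powr_realpow[symmetric] powr_diff[symmetric])
  have pK': "2 powr (- real_of_int j) = 2 ^ N / 2 ^ K"
    by (simp add: powr_minus pK)
  have mass: "levy_mass j \<gamma> l = real n * (1 / 2 ^ (K - l))"
    and atom: "t * levy_atom j \<gamma> l = t / real n * 2 ^ (K - l)" if "l < K" for l
  proof -
    have "(2::real) ^ (K - l) = 2 ^ K / 2 ^ l" using that by (simp add: power_diff)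
    then show "levy_mass j \<gamma> l = real n * (1 / 2 ^ (K - l))"
      "t * levy_atom j \<gamma> l = t / real n * 2 ^ (K - l)"
      using \<gamma> by (simp_all add: levy_mass_def levy_atom_def ng pK pK' power_divide)
  qed
  have massK: "\<gamma> * 2 powr (- real_of_int j) = real n / 2 ^ K" by (simp add: ng pK')
  let ?h = "\<lambda>k. of_real (1 / 2 ^ k) * (iexp (t / real n * 2 ^ k) - 1)"
  have it: "of_real (levy_mass j \<gamma> l) * (iexp (t * levy_atom j \<gamma> l) - 1) = levy_term j \<gamma> t l + \<i> * of_real t" for l
  proof -
    have "levy_mass j \<gamma> l * (t * levy_atom j \<gamma> l) = t" using levy_mass_atom[OF \<gamma>, of j l]
      by (metis mult.left_commute mult.right_neutral)
    then have "complex_of_real (levy_mass j \<gamma> l) * (\<i> * of_real (t * levy_atom j \<gamma> l)) = \<i> * of_real t"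
      by (metis mult.left_commute of_real_mult)
    then show ?thesis by (simp add: levy_term_def right_diff_distrib)
  qed
  have "of_nat n * (\<Sum>k\<in>{1..K}. ?h k) = (\<Sum>k\<in>{1..K}. of_real (real n) * ?h k)"
    by (simp add: sum_distrib_left)
  also have "\<dots> = (\<Sum>l<K. of_real (real n) * ?h (K - l))"
    by (rule sum.reindex_bij_witness[of _ "\<lambda>l. K - l" "\<lambda>k. K - k"]) auto
  also have "\<dots> = (\<Sum>l<K. levy_term j \<gamma> t l + \<i> * of_real t)"
  proof (rule sum.cong[OF refl])
    fix l assume "l \<in> {..<K}"
    then have "of_real (real n) * ?h (K - l) = of_real (levy_mass j \<gamma> l) * (iexp (t * levy_atom j \<gamma> l) - 1)"
      by (simp only: mass atom lessThan_iff of_real_mult mult.assoc)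
    then show "of_real (real n) * ?h (K - l) = levy_term j \<gamma> t l + \<i> * of_real t"
      by (simp only: it)
  qed
  also have "\<dots> = (\<Sum>l<K. levy_term j \<gamma> t l) + \<i> * of_real (t * real K)"
    by (simp add: sum.distrib)
  also have "(\<Sum>l<K. levy_term j \<gamma> t l) = (\<Sum>l. levy_term j \<gamma> t l) - (\<Sum>l. levy_term j \<gamma> t (l + K))"
    using suminf_split_initial_segment[OF summable_norm_cancel[OF summable_norm_levy_term[OF \<gamma>]], of j t K] by simp
  finally have "of_nat n * (\<Sum>k\<in>{1..K}. ?h k) = (\<Sum>l. levy_term j \<gamma> t l) - (\<Sum>l. levy_term j \<gamma> t (l + K)) + \<i> * of_real (t * real K)" .
  then have "of_nat n * (trunc_char K (t / real n) - 1) = (\<Sum>l. levy_term j \<gamma> t l) - (\<Sum>l. levy_term j \<gamma> t (l + K))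
      + \<i> * of_real (t * real K) - of_real (\<gamma> * 2 powr (- real_of_int j))"
    unfolding trunc_char_minus_1 right_diff_distrib by (simp add: massK)
  moreover have "t * real K - t * log 2 (real n) = t * (real_of_int j - log 2 \<gamma>)"
    using log_scale[OF n] by (simp add: rK N_def \<gamma>_def algebra_simps)
  then have "\<i> * of_real (t * real K) - \<i> * of_real (t * log 2 (real n)) = \<i> * of_real (t * (real_of_int j - log 2 \<gamma>))"
    by (metis of_real_diff right_diff_distrib)
  \<comment> \<open>Separates the ring arithmetic from the large terms it is applied to.\<close>
  moreover have "a - b = u + s - p - r" if "a = s - r + c - p" "c - b = u" for a b c p r s u :: complex
    using that by (simp add: algebra_simps)
  ultimately show "of_nat n * (trunc_char (level n j) (t / real n) - 1) - \<i> * of_real (t * log 2 (real n))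
    = levy_exponent j \<gamma> t - of_real (\<gamma> * 2 powr (- real_of_int j)) - (\<Sum>l. levy_term j \<gamma> t (l + level n j))"
    unfolding K_def[symmetric] levy_exponent_def by blast
  have "(\<lambda>l. t\<^sup>2 / 2 * (1 / real n * (1 / 2) ^ l)) sums (t\<^sup>2 / 2 * (1 / real n * (1 / (1 - 1 / 2))))"
    by (intro sums_mult geometric_sums) simp
  moreover have "norm (levy_term j \<gamma> t (l + K)) \<le> t\<^sup>2 / 2 * (1 / real n * (1 / 2) ^ l)" for l
  proof -
    have "levy_atom j \<gamma> (l + K) = 1 / real n * (1 / 2) ^ l"
      by (simp add: levy_atom_def pK ng power_add power_divide)
    then show ?thesis using norm_levy_term[OF \<gamma>, of j t "l + K"] by simp
  qed
  ultimately have "norm (\<Sum>l. levy_term j \<gamma> t (l + K)) \<le> t\<^sup>2 / 2 * (1 / real n * (1 / (1 - 1 / 2)))"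
    by (metis (no_types, lifting) norm_suminf_le sums_iff)
  then show "norm (\<Sum>l. levy_term j \<gamma> t (l + level n j)) \<le> t\<^sup>2 / real n"
    unfolding K_def by simp
qed

definition level_char :: "nat \<Rightarrow> int \<Rightarrow> real \<Rightarrow> complex" where
  "level_char n j t = trunc_char (level n j) (t / real n) ^ n * iexp (- (t * log 2 (real n)))"

lemma norm_psi_le_1: "\<gamma> > 0 \<Longrightarrow> norm (psi j \<gamma> t) \<le> 1"
  using Re_levy_exponent_nonpos[of \<gamma> j t] by (simp add: psi_def add_increasing2 order_trans)

text \<open>The target moves with \<open>scale_frac n\<close>, hence a difference. It has two
  sources: replacing the power by an exponential, and the dropped small atoms.\<close>

lemma level_char_minus_psi_tendsto_0:
  "(\<lambda>n. level_char n j t - psi j (scale_frac n) t) \<longlonglongrightarrow> 0"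
proof (rule Lim_null_comparison)
  let ?r = "\<lambda>n. \<Sum>l. levy_term j (scale_frac n) t (l + level n j)"
  \<comment> \<open>The bound of \<open>norm_power_minus_exp\<close>, using
    \<open>1 / 2^K = \<gamma> 2^(-j) / n\<close> with \<open>\<gamma> \<le> 1\<close>, and
    \<open>K \<le> log 2 n + 1 + \<bar>j\<bar>\<close>.\<close>
  let ?e1 = "\<lambda>n. exp 2 * ((2 powr (- real_of_int j) + (log 2 (real n) + 1 + \<bar>real_of_int j\<bar>) * \<bar>t\<bar>)\<^sup>2 / real n)"
  have ev: "\<forall>\<^sub>F n in sequentially. n \<ge> 1 \<and> int (scale_exp n) + j \<ge> 0"
  proof -
    have "\<forall>\<^sub>F n in sequentially. nat \<bar>j\<bar> \<le> scale_exp n"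
      using filterlim_scale_exp by (simp add: filterlim_at_top)
    moreover have "\<forall>\<^sub>F n in sequentially. n \<ge> (1::nat)" by (rule eventually_ge_at_top)
    ultimately show ?thesis by eventually_elim linarith
  qed
  then show "\<forall>\<^sub>F n in sequentially. norm (level_char n j t - psi j (scale_frac n) t) \<le> ?e1 n + norm (exp (- ?r n) - 1)"
  proof eventually_elim
    case (elim n)
    define a where "a = trunc_char (level n j) (t / real n)"
    define \<gamma> where "\<gamma> = scale_frac n"
    have n: "n \<ge> 1" and n0: "real n > 0" using elim by auto
    have \<gamma>: "\<gamma> > 0" "\<gamma> \<le> 1" using scale_frac_ge[OF n] scale_frac_le[OF n] by (auto simp: \<gamma>_def)
    have a1: "norm a \<le> 1" unfolding a_def by (rule norm_trunc_char_le_1)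
    have K: "real (level n j) = real (scale_exp n) + real_of_int j"
      using elim unfolding level_def by (simp add: of_nat_nat)
    have "norm (a - 1) \<le> 1 / 2 ^ level n j + real (level n j) * \<bar>t / real n\<bar>"
      unfolding a_def by (rule norm_trunc_char_minus_1)
    also have "1 / 2 ^ level n j = \<gamma> * 2 powr (- real_of_int j) / real n"
    proof -
      have "2 ^ level n j = 2 ^ scale_exp n * 2 powr real_of_int j"
        by (simp add: powr_realpow[symmetric] powr_add[symmetric] K)
      then show ?thesis using \<gamma> by (simp add: scale_eq[OF n] \<gamma>_def[symmetric] powr_minus divide_inverse mult_ac)
    qed
    also have "\<gamma> * 2 powr (- real_of_int j) / real n + real (level n j) * \<bar>t / real n\<bar>
        = (\<gamma> * 2 powr (- real_of_int j) + real (level n j) * \<bar>t\<bar>) / real n"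
      using n0 by (simp add: add_divide_distrib)
    also have "\<dots> \<le> (2 powr (- real_of_int j) + (log 2 (real n) + 1 + \<bar>real_of_int j\<bar>) * \<bar>t\<bar>) / real n"
    proof (intro divide_right_mono add_mono mult_right_mono)
      show "\<gamma> * 2 powr (- real_of_int j) \<le> 2 powr (- real_of_int j)"
        using \<gamma> by (simp add: mult_left_le_one_le)
      show "real (level n j) \<le> log 2 (real n) + 1 + \<bar>real_of_int j\<bar>"
        using K scale_exp_le[OF n] by linarith
    qed auto
    finally have d: "norm (a - 1) \<le> (2 powr (- real_of_int j) + (log 2 (real n) + 1 + \<bar>real_of_int j\<bar>) * \<bar>t\<bar>) / real n" .
    have "real n * (exp 2 * (norm (a - 1))\<^sup>2)
        \<le> real n * (exp 2 * ((2 powr (- real_of_int j) + (log 2 (real n) + 1 + \<bar>real_of_int j\<bar>) * \<bar>t\<bar>) / real n)\<^sup>2)"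
      using d by (intro mult_left_mono power_mono) auto
    also have "\<dots> = ?e1 n" using n0 by (simp add: power2_eq_square)
    finally have 1: "norm (a ^ n - exp (of_nat n * (a - 1))) \<le> ?e1 n"
      using norm_power_minus_exp[OF a1, of n] by linarith
    let ?c = "iexp (- (t * log 2 (real n)))"
    have "exp (of_nat n * (a - 1)) * ?c = exp (of_nat n * (a - 1) - \<i> * of_real (t * log 2 (real n)))"
      by (simp add: exp_add[symmetric])
    also have "\<dots> = psi j \<gamma> t * exp (- ?r n)"
      using levy_exponent_partial(1)[OF n, of j t] elim
      by (simp add: a_def \<gamma>_def psi_def exp_add[symmetric])
    finally have "level_char n j t - psi j \<gamma> t = (a ^ n - exp (of_nat n * (a - 1))) * ?c + psi j \<gamma> t * (exp (- ?r n) - 1)"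
      by (simp add: level_char_def a_def[symmetric] algebra_simps)
    then have "norm (level_char n j t - psi j \<gamma> t)
        \<le> norm ((a ^ n - exp (of_nat n * (a - 1))) * ?c) + norm (psi j \<gamma> t * (exp (- ?r n) - 1))"
      by (simp only: norm_triangle_ineq)
    also have "norm ((a ^ n - exp (of_nat n * (a - 1))) * ?c) = norm (a ^ n - exp (of_nat n * (a - 1)))"
      unfolding norm_mult norm_exp_i_times by simp
    also have "\<dots> \<le> ?e1 n" by (rule 1)
    also have "norm (psi j \<gamma> t * (exp (- ?r n) - 1)) \<le> 1 * norm (exp (- ?r n) - 1)"
      unfolding norm_mult by (intro mult_right_mono norm_psi_le_1[OF \<gamma>(1)]) simp
    finally show ?case by (simp add: \<gamma>_def)
  qed
  have "?r \<longlonglongrightarrow> 0"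
  proof (rule Lim_null_comparison)
    show "\<forall>\<^sub>F n in sequentially. norm (?r n) \<le> t\<^sup>2 / real n"
      using ev by eventually_elim (intro levy_exponent_partial(2), auto)
    show "(\<lambda>n. t\<^sup>2 / real n) \<longlonglongrightarrow> 0" by real_asymp
  qed
  then have "(\<lambda>n. norm (exp (- ?r n) - 1)) \<longlonglongrightarrow> norm (exp (- 0) - 1 :: complex)"
    by (intro tendsto_intros)
  moreover have "?e1 \<longlonglongrightarrow> 0"
  proof -
    define c d where "c = 2 powr (- real_of_int j)" and "d = 1 + \<bar>real_of_int j\<bar>"
    \<comment> \<open>Moving \<open>1 / sqrt n\<close> inside the square leaves only
      \<open>log 2 n / sqrt n\<close> and \<open>1 / sqrt n\<close> to be estimated.\<close>
    have "(\<lambda>n. exp 2 * (c * (1 / sqrt (real n)) + (log 2 (real n) / sqrt (real n) + d * (1 / sqrt (real n))) * \<bar>t\<bar>)\<^sup>2)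
        \<longlonglongrightarrow> exp 2 * (c * 0 + (0 + d * 0) * \<bar>t\<bar>)\<^sup>2"
      by (intro tendsto_intros) real_asymp+
    moreover have "(c * (1 / sqrt (real n)) + (log 2 (real n) / sqrt (real n) + d * (1 / sqrt (real n))) * \<bar>t\<bar>)\<^sup>2
        = (c + (log 2 (real n) + 1 + \<bar>real_of_int j\<bar>) * \<bar>t\<bar>)\<^sup>2 / real n" for n
    proof -
      have "c * (1 / sqrt (real n)) + (log 2 (real n) / sqrt (real n) + d * (1 / sqrt (real n))) * \<bar>t\<bar>
          = (c + (log 2 (real n) + 1 + \<bar>real_of_int j\<bar>) * \<bar>t\<bar>) / sqrt (real n)"
        by (simp add: d_def add_divide_distrib algebra_simps)
      then show ?thesis by (simp add: power_divide)
    qed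
    ultimately have "(\<lambda>n. exp 2 * ((c + (log 2 (real n) + 1 + \<bar>real_of_int j\<bar>) * \<bar>t\<bar>)\<^sup>2 / real n))
        \<longlonglongrightarrow> exp 2 * (c * 0 + (0 + d * 0) * \<bar>t\<bar>)\<^sup>2"
      by (simp only:)
    then show ?thesis by (simp add: c_def)
  qed
  ultimately show "(\<lambda>n. ?e1 n + norm (exp (- ?r n) - 1)) \<longlonglongrightarrow> 0"
    using tendsto_add[of ?e1 0 sequentially] by fastforce
qed

section \<open>Uniform convergence\<close>

text \<open>Since \<open>e J\<close> does not depend on \<open>n\<close>, \<open>J\<close> can be
  fixed first; then only truncated sums have to converge.\<close>

lemma tendsto_diff_0_by_truncation:
  fixes a b :: "nat \<Rightarrow> complex"
  assumes a: "\<And>J. \<forall>\<^sub>F n in sequentially. norm (a n - SA J n) \<le> e J"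
    and b: "\<And>J. \<forall>\<^sub>F n in sequentially. norm (b n - SB J n) \<le> e J"
    and e: "e \<longlonglongrightarrow> (0::real)" and S: "\<And>J. (\<lambda>n. SA J n - SB J n) \<longlonglongrightarrow> 0"
  shows "(\<lambda>n. a n - b n) \<longlonglongrightarrow> 0"
proof (rule tendstoI)
  fix \<epsilon> :: real assume \<epsilon>: "\<epsilon> > 0"
  have "\<forall>\<^sub>F J in sequentially. e J < \<epsilon> / 3" using e \<epsilon> by (intro order_tendstoD) auto
  then obtain J :: nat where J: "e J < \<epsilon> / 3" by (auto simp: eventually_sequentially)
  have "\<forall>\<^sub>F n in sequentially. norm (SA J n - SB J n) < \<epsilon> / 3"
    using tendstoD[OF S[of J], of "\<epsilon> / 3"] \<epsilon> by simp
  then show "\<forall>\<^sub>F n in sequentially. dist (a n - b n) 0 < \<epsilon>"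
    using a[of J] b[of J]
  proof eventually_elim
    case (elim n)
    have "a n - b n = (a n - SA J n) + (SA J n - SB J n) - (b n - SB J n)" by simp
    also have "norm \<dots> \<le> norm (a n - SA J n) + norm (SA J n - SB J n) + norm (b n - SB J n)"
      by (rule order_trans[OF norm_triangle_ineq4 add_right_mono[OF norm_triangle_ineq]])
    finally show ?case using elim J by simp
  qed
qed

lemma truncation_error_tendsto_0: "(\<lambda>J::nat. 1 / 2 ^ J + exp (- (2 ^ J)) :: real) \<longlonglongrightarrow> 0"
  by real_asymp

text \<open>Continuity in the parameter passes through the infinite sum over levels because the
  truncation error is uniform in the parameter.\<close>

lemma char_Gstar_law_tendsto:
  fixes g :: "nat \<Rightarrow> real"
  assumes g: "g \<longlonglongrightarrow> \<gamma>" and ge: "\<And>n. 1 / 2 \<le> g n" and le: "\<And>n. g n \<le> 1"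
  shows "(\<lambda>n. char (Gstar_law (g n)) t) \<longlonglongrightarrow> char (Gstar_law \<gamma>) t"
proof -
  have \<gamma>: "1 / 2 \<le> \<gamma>" "\<gamma> \<le> 1"
    using LIMSEQ_le_const[OF g] LIMSEQ_le_const2[OF g] ge le by blast+
  have psi: "(\<lambda>n. psi j (g n) t) \<longlonglongrightarrow> psi j \<gamma> t" for j
    unfolding psi_def using g by (intro tendsto_intros tendsto_levy_exponent ge \<gamma>)
  have jump: "(\<lambda>n. jump_factor j (g n) t) \<longlonglongrightarrow> jump_factor j \<gamma> t" for j
    unfolding jump_factor_def using g \<gamma> by (intro tendsto_intros) auto
  have "(\<lambda>n. char (Gstar_law (g n)) t - char (Gstar_law \<gamma>) t) \<longlonglongrightarrow> 0"
  proof (rule tendsto_diff_0_by_truncation[OF _ _ truncation_error_tendsto_0])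
    fix J
    let ?S = "\<lambda>J \<gamma>. \<Sum>j\<in>{- int J..int J}. jump_factor j \<gamma> t * (psi j \<gamma> t - psi (j - 1) \<gamma> t)"
    show "\<forall>\<^sub>F n in sequentially. norm (char (Gstar_law (g n)) t - ?S J (g n)) \<le> 1 / 2 ^ J + exp (- (2 ^ J))"
      using char_Gstar_law_truncate[OF ge le] by (intro always_eventually) blast
    show "\<forall>\<^sub>F n in sequentially. norm (char (Gstar_law \<gamma>) t - ?S J \<gamma>) \<le> 1 / 2 ^ J + exp (- (2 ^ J))"
      using char_Gstar_law_truncate[OF \<gamma>] by (intro always_eventually) blast
    have "(\<lambda>n. ?S J (g n)) \<longlonglongrightarrow> ?S J \<gamma>" by (intro tendsto_intros psi jump)
    then show "(\<lambda>n. ?S J (g n) - ?S J \<gamma>) \<longlonglongrightarrow> 0" by (simp add: LIM_zero)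
  qed
  then show ?thesis by (simp add: LIM_zero_iff)
qed

context petersburg_sequence
begin

definition trimmed :: "nat \<Rightarrow> 'a \<Rightarrow> real" where
  "trimmed n \<omega> = (total n \<omega> - largest n \<omega>) / real n - log 2 (real n)"

lemma measurable_trimmed [measurable]: "trimmed n \<in> borel_measurable M"
  unfolding trimmed_def[abs_def] by measurable

text \<open>Levels \<open>j\<close> in \<open>-J..J\<close> correspond to \<open>K = N + j\<close>
  in \<open>Suc K1..K2\<close>; \<open>Suc J \<le> N\<close> keeps the natural subtraction in
  \<open>K1\<close> exact. Then \<open>n / 2^K2 = \<gamma> / 2^J\<close> and
  \<open>n / 2^K1 = 2 \<gamma> 2^J\<close> reproduce the error bound of
  \<open>char_Gstar_law_truncate\<close>.\<close>

lemma char_trimmed_truncate: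
  assumes n: "n \<ge> 1" and J: "Suc J \<le> scale_exp n"
  shows "norm (char (distr M borel (trimmed n)) t
    - (\<Sum>j\<in>{- int J..int J}. jump_factor j (scale_frac n) t * (level_char n j t - level_char n (j - 1) t)))
    \<le> 1 / 2 ^ J + exp (- (2 ^ J))"
proof -
  define N where "N = scale_exp n"
  define \<gamma> where "\<gamma> = scale_frac n"
  define s where "s = t / real n"
  define K1 where "K1 = N - Suc J"
  define K2 where "K2 = N + J"
  let ?c = "iexp (- (t * log 2 (real n)))"
  let ?f = "\<lambda>K. iexp (- (s * 2 ^ K)) * (trunc_char K s ^ n - trunc_char (K - 1) s ^ n)"
  have ng: "real n = \<gamma> * 2 ^ N" using scale_eq[OF n] by (simp add: \<gamma>_def N_def)
  have \<gamma>: "1 / 2 \<le> \<gamma>" "\<gamma> \<le> 1" using scale_frac_ge[OF n] scale_frac_le[OF n] by (auto simp: \<gamma>_def)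
  have NJ: "Suc J \<le> N" using J by (simp add: N_def)
  have char: "char (distr M borel (trimmed n)) t = ?c * (\<integral>\<omega>. iexp (s * (total n \<omega> - largest n \<omega>)) \<partial>M)"
  proof -
    have e: "iexp (t * trimmed n \<omega>) = ?c * iexp (s * (total n \<omega> - largest n \<omega>))" for \<omega>
    proof -
      have "t * trimmed n \<omega> = - (t * log 2 (real n)) + s * (total n \<omega> - largest n \<omega>)"
        by (simp add: trimmed_def s_def diff_divide_distrib algebra_simps)
      then show ?thesis by (simp only: of_real_add distrib_left exp_add)
    qed
    have "char (distr M borel (trimmed n)) t = (\<integral>\<omega>. iexp (t * trimmed n \<omega>) \<partial>M)"
      unfolding char_def by (subst integral_distr) auto
    also have "\<dots> = ?c * (\<integral>\<omega>. iexp (s * (total n \<omega> - largest n \<omega>)) \<partial>M)"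
      unfolding e by (rule integral_mult_right_zero)
    finally show ?thesis .
  qed
  have "?c * (\<Sum>K\<in>{Suc K1..K2}. ?f K) = (\<Sum>K\<in>{Suc K1..K2}. ?c * ?f K)" by (rule sum_distrib_left)
  also have "\<dots> = (\<Sum>j\<in>{- int J..int J}. jump_factor j \<gamma> t * (level_char n j t - level_char n (j - 1) t))"
  proof (rule sum.reindex_bij_witness[of _ "\<lambda>j. nat (int N + j)" "\<lambda>K. int K - int N"])
    fix K assume K: "K \<in> {Suc K1..K2}"
    then have K0: "K \<ge> 1" by simp
    define j where "j = int K - int N"
    have lev: "level n j = K" "level n (j - 1) = K - 1"
      using K0 by (auto simp: level_def j_def N_def)
    have "2 powr real_of_int j = 2 ^ K / 2 ^ N"
      by (simp add: j_def powr_diff powr_realpow)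
    then have "t * (2 powr real_of_int j / \<gamma>) = s * 2 ^ K" by (simp add: s_def ng)
    then have "jump_factor j \<gamma> t = iexp (- (s * 2 ^ K))" by (simp only: jump_factor_def)
    then show "jump_factor (int K - int N) \<gamma> t * (level_char n (int K - int N) t - level_char n (int K - int N - 1) t) = ?c * ?f K"
      unfolding j_def[symmetric] level_char_def lev s_def[symmetric]
      by (simp add: algebra_simps)
  qed (use NJ in \<open>auto simp: K1_def K2_def\<close>)
  finally have sum: "(\<Sum>j\<in>{- int J..int J}. jump_factor j \<gamma> t * (level_char n j t - level_char n (j - 1) t))
    = ?c * (\<Sum>K\<in>{Suc K1..K2}. ?f K)" by simp
  have "norm (char (distr M borel (trimmed n)) t - ?c * (\<Sum>K\<in>{Suc K1..K2}. ?f K))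
    = norm ((\<integral>\<omega>. iexp (s * (total n \<omega> - largest n \<omega>)) \<partial>M) - (\<Sum>K\<in>{Suc K1..K2}. ?f K))"
    unfolding char right_diff_distrib[symmetric] norm_mult norm_exp_i_times by simp
  also have "\<dots> \<le> real n / 2 ^ K2 + exp (- (real n / 2 ^ K1))"
    by (rule expectation_trimmed_truncate[OF n]) (simp add: K1_def K2_def)
  also have "\<dots> \<le> 1 / 2 ^ J + exp (- (2 ^ J))"
  proof (rule add_mono)
    show "real n / 2 ^ K2 \<le> 1 / 2 ^ J"
      using \<gamma> by (simp add: ng K2_def power_add divide_right_mono)
    have "(2::real) ^ N = 2 ^ K1 * 2 ^ Suc J"
      unfolding power_add[symmetric] K1_def using NJ by simp
    then have "real n / 2 ^ K1 = (2 * \<gamma>) * 2 ^ J" by (simp add: ng)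
    moreover have "1 * 2 ^ J \<le> (2 * \<gamma>) * 2 ^ J" using \<gamma> by (intro mult_right_mono) auto
    ultimately show "exp (- (real n / 2 ^ K1)) \<le> exp (- (2 ^ J))" by simp
  qed
  finally show ?thesis unfolding sum[symmetric] \<gamma>_def .
qed

lemma char_trimmed_minus_char_Gstar_law:
  "(\<lambda>n. char (distr M borel (trimmed n)) t - char (Gstar_law (scale_frac n)) t) \<longlonglongrightarrow> 0"
proof (rule tendsto_diff_0_by_truncation[OF _ _ truncation_error_tendsto_0])
  fix J
  let ?A = "\<lambda>J n. \<Sum>j\<in>{- int J..int J}. jump_factor j (scale_frac n) t * (level_char n j t - level_char n (j - 1) t)"
  let ?B = "\<lambda>J n. \<Sum>j\<in>{- int J..int J}. jump_factor j (scale_frac n) t * (psi j (scale_frac n) t - psi (j - 1) (scale_frac n) t)"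
  have ge1: "\<forall>\<^sub>F n in sequentially. n \<ge> (1::nat)" by (rule eventually_ge_at_top)
  have "\<forall>\<^sub>F n in sequentially. Suc J \<le> scale_exp n"
    using filterlim_scale_exp by (simp only: filterlim_at_top)
  with ge1 show "\<forall>\<^sub>F n in sequentially. norm (char (distr M borel (trimmed n)) t - ?A J n) \<le> 1 / 2 ^ J + exp (- (2 ^ J))"
    by eventually_elim (rule char_trimmed_truncate)
  show "\<forall>\<^sub>F n in sequentially. norm (char (Gstar_law (scale_frac n)) t - ?B J n) \<le> 1 / 2 ^ J + exp (- (2 ^ J))"
    using ge1 by eventually_elim (intro char_Gstar_law_truncate scale_frac_ge scale_frac_le)
  have "(\<lambda>n. ?A J n - ?B J n) = (\<lambda>n. \<Sum>j\<in>{- int J..int J}. jump_factor j (scale_frac n) t *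
      ((level_char n j t - psi j (scale_frac n) t) - (level_char n (j - 1) t - psi (j - 1) (scale_frac n) t)))"
    unfolding sum_subtractf[symmetric] by (intro ext sum.cong) (auto simp: algebra_simps)
  also have "\<dots> \<longlonglongrightarrow> (\<Sum>j\<in>{- int J..int J}. 0)"
  proof (rule tendsto_sum)
    fix j
    let ?d = "\<lambda>n. (level_char n j t - psi j (scale_frac n) t) - (level_char n (j - 1) t - psi (j - 1) (scale_frac n) t)"
    have "?d \<longlonglongrightarrow> 0 - 0" by (intro tendsto_diff level_char_minus_psi_tendsto_0)
    \<comment> \<open>The jump factor need not converge, as \<open>scale_frac n\<close> oscillates;
      it has modulus 1, so a comparison of norms suffices.\<close>
    then have "(\<lambda>n. norm (?d n)) \<longlonglongrightarrow> 0" by (simp add: tendsto_norm_zero)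
    then show "(\<lambda>n. jump_factor j (scale_frac n) t * ?d n) \<longlonglongrightarrow> 0"
      by (rule Lim_null_comparison[rotated])
         (simp only: norm_mult jump_factor_def norm_exp_i_times mult_1 order_refl eventually_True)
  qed
  finally show "(\<lambda>n. ?A J n - ?B J n) \<longlonglongrightarrow> 0" by simp
qed

lemma eventually_cdf_trimmed_near_Gstar:
  assumes \<epsilon>: "\<epsilon> > 0"
  shows "\<forall>\<^sub>F n in sequentially. \<forall>x. \<bar>cdf (distr M borel (trimmed n)) x - Gstar (scale_frac n) x\<bar> \<le> \<epsilon>"
proof (rule ccontr)
  let ?F = "\<lambda>n. distr M borel (trimmed n)"
  \<comment> \<open>The guard \<open>n \<ge> 1\<close> makes every index of a bad subsequence
    positive, so the bounds on \<open>scale_frac\<close> hold along all of it.\<close>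
  let ?P = "\<lambda>n. n \<ge> 1 \<longrightarrow> (\<forall>x. \<bar>cdf (?F n) x - Gstar (scale_frac n) x\<bar> \<le> \<epsilon>)"
  assume "\<not> (\<forall>\<^sub>F n in sequentially. \<forall>x. \<bar>cdf (?F n) x - Gstar (scale_frac n) x\<bar> \<le> \<epsilon>)"
  moreover have "\<forall>\<^sub>F n in sequentially. \<forall>x. \<bar>cdf (?F n) x - Gstar (scale_frac n) x\<bar> \<le> \<epsilon>"
    if "\<forall>\<^sub>F n in sequentially. ?P n"
    using that eventually_ge_at_top[of "1::nat"] by eventually_elim blast
  ultimately have notP: "\<not> (\<forall>\<^sub>F n in sequentially. ?P n)" by blast
  obtain r :: "nat \<Rightarrow> nat" where r: "strict_mono r" "\<And>k. \<not> ?P (r k)"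
    using not_eventually_sequentiallyD[OF notP] by auto
  have r1: "r k \<ge> 1" for k using r(2)[of k] by blast
  have "\<forall>k. scale_frac (r k) \<in> {1 / 2..1}"
    using scale_frac_ge[OF r1] scale_frac_le[OF r1] by simp
  moreover have "compact {1 / 2..1::real}" by (rule compact_Icc)
  ultimately obtain \<gamma> q where \<gamma>: "\<gamma> \<in> {1 / 2..1}" and q: "strict_mono q" "((\<lambda>k. scale_frac (r k)) \<circ> q) \<longlonglongrightarrow> \<gamma>"
    unfolding compact_def by metis
  define w where "w k = r (q k)" for k
  have w: "strict_mono w" using r(1) q(1) by (auto simp: w_def strict_mono_def)
  have w1: "w k \<ge> 1" for k using r1 by (simp add: w_def)
  have lim: "(\<lambda>k. scale_frac (w k)) \<longlonglongrightarrow> \<gamma>" using q(2) by (simp add: w_def comp_def)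
  have \<gamma>0: "\<gamma> > 0" using \<gamma> by auto
  have frac0: "scale_frac (w k) > 0" for k using scale_frac_ge[OF w1[of k]] by linarith
  let ?H = "Gstar_law \<gamma>"
  have rdH: "real_distribution ?H" by (rule real_distribution_Gstar_law[OF \<gamma>0])
  have rdF: "real_distribution (?F (w k))" for k by (rule real_distribution_distr) measurable
  have rdG: "real_distribution (Gstar_law (scale_frac (w k)))" for k
    by (rule real_distribution_Gstar_law[OF frac0])
  have charG: "(\<lambda>k. char (Gstar_law (scale_frac (w k))) t) \<longlonglongrightarrow> char ?H t" for t
    by (rule char_Gstar_law_tendsto[OF lim]) (rule scale_frac_ge[OF w1] scale_frac_le[OF w1])+
  have charF: "(\<lambda>k. char (?F (w k)) t) \<longlonglongrightarrow> char ?H t" for t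
  proof -
    have "(\<lambda>k. char (?F (w k)) t - char (Gstar_law (scale_frac (w k))) t) \<longlonglongrightarrow> 0"
      using LIMSEQ_subseq_LIMSEQ[OF char_trimmed_minus_char_Gstar_law[of t] w] by (simp add: comp_def)
    from tendsto_add[OF this charG[of t]] show ?thesis by simp
  qed
  have "\<forall>\<^sub>F k in sequentially. \<forall>x. \<bar>cdf (?F (w k)) x - cdf ?H x\<bar> \<le> \<epsilon> / 2"
    using \<epsilon> by (intro weak_conv_uniform_cdf levy_continuity rdF rdH charF Gstar_law_no_atoms \<gamma>0) auto
  moreover have "\<forall>\<^sub>F k in sequentially. \<forall>x. \<bar>cdf (Gstar_law (scale_frac (w k))) x - cdf ?H x\<bar> \<le> \<epsilon> / 2"
    using \<epsilon> by (intro weak_conv_uniform_cdf levy_continuity rdG rdH charG Gstar_law_no_atoms \<gamma>0) auto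
  ultimately have "\<forall>\<^sub>F k in sequentially. ?P (w k)"
  proof eventually_elim
    case (elim k)
    show ?case
    proof (intro impI allI)
      fix x
      have "\<bar>cdf (?F (w k)) x - cdf ?H x\<bar> \<le> \<epsilon> / 2" "\<bar>Gstar (scale_frac (w k)) x - cdf ?H x\<bar> \<le> \<epsilon> / 2"
        using elim by (auto simp: Gstar_eq_cdf[OF frac0])
      then show "\<bar>cdf (?F (w k)) x - Gstar (scale_frac (w k)) x\<bar> \<le> \<epsilon>" by linarith
    qed
  qed
  then obtain k where "?P (w k)" by (auto simp: eventually_sequentially)
  then show False using r(2)[of "q k"] by (simp add: w_def)
qed

end

theorem theorem2:
  fixes M :: "'a measure" and X :: "nat \<Rightarrow> 'a \<Rightarrow> real"
  assumes "prob_space M"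
    and "prob_space.indep_vars M (\<lambda>_. borel) X {1..}"
    and "\<And>i k. i \<ge> 1 \<Longrightarrow> k \<ge> 1 \<Longrightarrow>
           measure M {\<omega> \<in> space M. X i \<omega> = 2 ^ k} = 1 / 2 ^ k"
  shows "(\<lambda>n::nat. SUP x::real. \<bar>measure M {\<omega> \<in> space M.
              ((\<Sum>i\<in>{1..n}. X i \<omega>) - Max ((\<lambda>i. X i \<omega>) ` {1..n})) / real n - log 2 (real n) \<le> x}
            - Gstar (real n / 2 powr (real_of_int \<lceil>log 2 (real n)\<rceil>)) x\<bar>)
         \<longlonglongrightarrow> 0"
proof -
  interpret petersburg_sequence M X
    using assms by (simp add: petersburg_sequence_def petersburg_sequence_axioms_def)
  have cdf: "measure M {\<omega> \<in> space M.
      ((\<Sum>i\<in>{1..n}. X i \<omega>) - Max ((\<lambda>i. X i \<omega>) ` {1..n})) / real n - log 2 (real n) \<le> x}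
    = cdf (distr M borel (trimmed n)) x" for n x
  proof -
    have "trimmed n -` {..x} \<inter> space M = {\<omega> \<in> space M.
      ((\<Sum>i\<in>{1..n}. X i \<omega>) - Max ((\<lambda>i. X i \<omega>) ` {1..n})) / real n - log 2 (real n) \<le> x}"
      by (auto simp: trimmed_def total_def largest_def)
    then show ?thesis by (simp add: cdf_def measure_distr)
  qed
  let ?D = "\<lambda>n x. \<bar>cdf (distr M borel (trimmed n)) x - Gstar (scale_frac n) x\<bar>"
  have "(\<lambda>n. SUP x. ?D n x) \<longlonglongrightarrow> 0"
  proof (rule tendstoI)
    fix \<epsilon> :: real assume \<epsilon>: "\<epsilon> > 0"
    then have "\<forall>\<^sub>F n in sequentially. \<forall>x. ?D n x \<le> \<epsilon> / 2"
      by (intro eventually_cdf_trimmed_near_Gstar) simp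
    then show "\<forall>\<^sub>F n in sequentially. dist (SUP x. ?D n x) 0 < \<epsilon>"
    proof eventually_elim
      case (elim n)
      then have "(SUP x. ?D n x) \<le> \<epsilon> / 2" by (intro cSUP_least) auto
      moreover have "0 \<le> ?D n 0" by simp
      \<comment> \<open>A real supremum is informative only for a bounded set; the uniform bound
        supplies this.\<close>
      moreover have "?D n 0 \<le> (SUP x. ?D n x)"
        using elim by (intro cSUP_upper bdd_aboveI[of _ "\<epsilon> / 2"]) auto
      ultimately show ?case using \<epsilon> by (simp add: dist_real_def)
    qed
  qed
  then show ?thesis unfolding cdf scale_frac_def .
qed

end
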